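(* Let $\mathcal V$ be a non-trivial integral commutative quantale without zero divisors, and let $T:\mathsf{Set}\to\mathsf{Set}$ be an arbitrary endofunctor, with $\mathcal V\text{-}\mathsf{cat}$-ification $T_{\mathcal V}:\mathcal V\text{-}\mathsf{cat}\to\mathcal V\text{-}\mathsf{cat}$ and $\mathsf{Preord}$-ification $T_{\mathbb 2}:\mathsf{Preord}\to\mathsf{Preord}$. Then the $\mathcal V\text{-}\mathsf{cat}$-adjunctions $C\dashv D$ (with $D:\mathsf{Set}\to\mathsf{Preord}$) and $\mathsf c_*\dashv\mathsf d_*$ (with $\mathsf d_*:\mathsf{Preord}\to\mathcal V\text{-}\mathsf{cat}$) lift to $\mathcal V\text{-}\mathsf{cat}$-adjunctions $\widetilde C\dashv\widetilde D$ (with $\widetilde D:\mathsf{Coalg}(T)\to\mathsf{Coalg}(T_{\mathbb 2})$) and $\widetilde{\mathsf c}_*\dashv\widetilde{\mathsf d}_*$ (with $\widetilde{\mathsf d}_*:\mathsf{Coalg}(T_{\mathbb 2})\to\mathsf{Coalg}(T_{\mathcal V})$) between the associated $\mathcal V\text{-}\mathsf{cat}$-categories of coalgebras, i.e. to adjunctions whose functors commute with the forgetful functors from coalgebras to $\mathsf{Set}$, $\mathsf{Preord}$ and $\mathcal V\text{-}\mathsf{cat}$, respectively.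
   Context: $\mathcal V=(\mathcal V_o,\otimes,e,[-,-])$ is a commutative quantale: a complete lattice with a commutative, associative, monotone operation $\otimes$ with unit $e$, such that each $-\otimes r$ has a right adjoint $[r,-]$. Non-trivial: $e\neq\bot$. Integral: $e=\top$. Without zero divisors: $r\otimes s=\bot$ implies $r=\bot$ or $s=\bot$. A (small) $\mathcal V$-category $\mathcal X$ is a set of objects together with elements $\mathcal X(x',x)\in\mathcal V_o$ satisfying $e\le\mathcal X(x,x)$ and $\mathcal X(x',x)\otimes\mathcal X(x'',x')\le\mathcal X(x'',x)$; a $\mathcal V$-functor $f:\mathcal X\to\mathcal Y$ is a map on objects with $\mathcal X(x',x)\le\mathcal Y(fx',fx)$. $\mathcal V\text{-}\mathsf{cat}$ is the symmetric monoidal closed category of small $\mathcal V$-categories, with internal hom $[\mathcal Y,\mathcal Z]$ of $\mathcal V$-functors with $[\mathcal Y,\mathcal Z](f,g)=\bigwedge_y\mathcal Z(fy,gy)$, enriched over itself. For the two-element quantale $\mathbb 2=\{0<1\}$ with $\otimes=\wedge$, $\mathbb 2\text{-}\mathsf{cat}=\mathsf{Preord}$, the category of preorders and monotone maps. $\mathsf d_*:\mathsf{Preord}\to\mathcal V\text{-}\mathsf{cat}$ sends a preorder $X$ to the $\mathcal V$-category with the same objects and $\mathsf d_*X(x',x)=e$ if $x'\le x$, $\bot$ otherwise. $\mathsf c_*:\mathcal V\text{-}\mathsf{cat}\to\mathsf{Preord}$ sends $\mathcal X$ to the preorder on the same objects with $x'\le x$ iff $\mathcal X(x',x)\neq\bot$.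 $D:\mathsf{Set}\to\mathsf{Preord}$ sends a set to its discrete preorder and $C:\mathsf{Preord}\to\mathsf{Set}$ sends a preorder to its set of connected components. $D^{\mathcal V}=\mathsf d_*D:\mathsf{Set}\to\mathcal V\text{-}\mathsf{cat}$ sends a set to the discrete $\mathcal V$-category on it. $\mathsf{Preord}$ (and any $\mathsf{Preord}$-enriched category or functor) is regarded as $\mathcal V\text{-}\mathsf{cat}$-enriched by applying $\mathsf d_*$ to the hom preorders, and $\mathsf{Set}$ by taking discrete homs; then $C\dashv D$ and $\mathsf c_*\dashv\mathsf d_*$ are $\mathcal V\text{-}\mathsf{cat}$-adjunctions. $T_{\mathcal V}=\mathrm{Lan}_{D^{\mathcal V}}(D^{\mathcal V}T)$ is the $\mathcal V\text{-}\mathsf{cat}$-enriched left Kan extension of $D^{\mathcal V}T$ along $D^{\mathcal V}$, and $T_{\mathbb 2}$ is the case $\mathcal V=\mathbb 2$, i.e. the $\mathsf{Preord}$-enriched left Kan extension of $DT$ along $D$. For an enriched endofunctor $S$ of $\mathbb X$, $\mathsf{Coalg}(S)$ is the enriched category whose objects are pairs $(X,c:X\to SX)$ and whose hom from $(X,c)$ to $(Y,d)$ is the full sub-$\mathcal V$-category of $\mathbb X(X,Y)$ on the $f$ with $d\circ f=S(f)\circ c$; the forgetful functor sends $(X,c)$ to $X$. *)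

theory Defs
  imports Main "HOL-Library.FuncSet"
begin

section \<open>Commutative quantales\<close>

text \<open>\<open>*\<close> is the tensor, \<open>1\<close> its unit \<open>e\<close>, and \<open>qhom r y\<close> is \<open>[r, y]\<close>.
  Monotonicity of the tensor follows from the adjunction.\<close>

class comm_quantale = complete_lattice + comm_monoid_mult +
  fixes qhom :: "'a \<Rightarrow> 'a \<Rightarrow> 'a"
  assumes qhom_adjoint: "x * r \<le> y \<longleftrightarrow> x \<le> qhom r y"

text \<open>The two-element quantale is \<^typ>\<open>bool\<close> with conjunction.\<close>

instantiation bool :: comm_quantale
begin
definition times_bool :: "bool \<Rightarrow> bool \<Rightarrow> bool" where "times_bool p q = (p \<and> q)"
definition one_bool :: bool where "one_bool = True"
definition qhom_bool :: "bool \<Rightarrow> bool \<Rightarrow> bool" where "qhom_bool p q = (p \<longrightarrow> q)"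
instance
  by standard (auto simp: times_bool_def one_bool_def qhom_bool_def)
end

section \<open>\<open>\<V>\<close>-categories\<close>

record ('a, 'v) vcat =
  vob :: "'a set"
  vhom :: "'a \<Rightarrow> 'a \<Rightarrow> 'v"

text \<open>The last conjunct fixes the junk values of \<open>vhom\<close>, so that equality of records is
  equality of \<open>\<V>\<close>-categories. A \<open>bool\<close>-category is a preorder, with \<open>vhom X x' x\<close>
  meaning \<open>x' \<le> x\<close>.\<close>

definition is_vcat :: "('a, 'v::comm_quantale) vcat \<Rightarrow> bool" where
  "is_vcat X \<longleftrightarrow>
     (\<forall>x\<in>vob X. 1 \<le> vhom X x x) \<and>
     (\<forall>x\<in>vob X. \<forall>x'\<in>vob X. \<forall>x''\<in>vob X. vhom X x' x * vhom X x'' x' \<le> vhom X x'' x) \<and>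
     (\<forall>x' x. x' \<notin> vob X \<or> x \<notin> vob X \<longrightarrow> vhom X x' x = bot)"

definition is_vfun :: "('a, 'v::comm_quantale) vcat \<Rightarrow> ('b, 'v) vcat \<Rightarrow> ('a \<Rightarrow> 'b) \<Rightarrow> bool" where
  "is_vfun X Y f \<longleftrightarrow> f \<in> vob X \<rightarrow>\<^sub>E vob Y \<and>
     (\<forall>x'\<in>vob X. \<forall>x\<in>vob X. vhom X x' x \<le> vhom Y (f x') (f x))"

definition vfun_cat ::
    "('a, 'v::comm_quantale) vcat \<Rightarrow> ('b, 'v) vcat \<Rightarrow> ('a \<Rightarrow> 'b, 'v) vcat" where
  "vfun_cat X Y =
     \<lparr>vob = {f. is_vfun X Y f},
      vhom = (\<lambda>f g. if is_vfun X Y f \<and> is_vfun X Y g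
                    then INF x\<in>vob X. vhom Y (f x) (g x) else bot)\<rparr>"

definition full_sub :: "('a, 'v::comm_quantale) vcat \<Rightarrow> ('a \<Rightarrow> bool) \<Rightarrow> ('a, 'v) vcat" where
  "full_sub X P =
     \<lparr>vob = {x \<in> vob X. P x}, vhom = (\<lambda>x' x. if P x' \<and> P x then vhom X x' x else bot)\<rparr>"

text \<open>Isomorphisms in \<open>\<V>\<close>-cat: bijections on objects that preserve homs on the nose.\<close>

definition is_viso :: "('a, 'v::comm_quantale) vcat \<Rightarrow> ('b, 'v) vcat \<Rightarrow> ('a \<Rightarrow> 'b) \<Rightarrow> bool" where
  "is_viso X Y f \<longleftrightarrow> bij_betw f (vob X) (vob Y) \<and>
     (\<forall>x'\<in>vob X. \<forall>x\<in>vob X. vhom Y (f x') (f x) = vhom X x' x)"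

definition d_star :: "('a, bool) vcat \<Rightarrow> ('a, 'v::comm_quantale) vcat" where
  "d_star X = \<lparr>vob = vob X, vhom = (\<lambda>x' x. if vhom X x' x then 1 else bot)\<rparr>"

definition c_star :: "('a, 'v::comm_quantale) vcat \<Rightarrow> ('a, bool) vcat" where
  "c_star X = \<lparr>vob = vob X, vhom = (\<lambda>x' x. vhom X x' x \<noteq> bot)\<rparr>"

definition discrete_preord :: "'a set \<Rightarrow> ('a, bool) vcat" where
  "discrete_preord A = \<lparr>vob = A, vhom = (\<lambda>x' x. x' \<in> A \<and> x' = x)\<rparr>"

definition connected_in :: "('a, bool) vcat \<Rightarrow> 'a \<Rightarrow> 'a \<Rightarrow> bool" where
  "connected_in X = (\<lambda>x y. vhom X x y \<or> vhom X y x)\<^sup>*\<^sup>*"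

text \<open>So that the set of connected components has the same element type as the preorder, a
  component is encoded by a chosen element of it.\<close>

definition component :: "('a, bool) vcat \<Rightarrow> 'a \<Rightarrow> 'a" where
  "component X x = (SOME y. connected_in X x y)"

section \<open>Categories enriched in \<open>\<V>\<close>-cat\<close>

record ('o, 'm, 'v) ecat =
  Obj :: "'o set"
  Hom :: "'o \<Rightarrow> 'o \<Rightarrow> ('m, 'v) vcat"
  Id :: "'o \<Rightarrow> 'm"
  Comp :: "'o \<Rightarrow> 'o \<Rightarrow> 'o \<Rightarrow> 'm \<Rightarrow> 'm \<Rightarrow> 'm"

abbreviation Arr :: "('o, 'm, 'v) ecat \<Rightarrow> 'o \<Rightarrow> 'o \<Rightarrow> 'm set" where
  "Arr \<A> A B \<equiv> vob (Hom \<A> A B)"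

text \<open>\<open>Comp \<A> A B C g f\<close> is \<open>g \<circ> f\<close> for \<open>f : A \<rightarrow> B\<close> and \<open>g : B \<rightarrow> C\<close>; the inequality
  says that composition is a \<open>\<V>\<close>-functor on the tensor product of the homs.\<close>

definition is_ecat :: "('o, 'm, 'v::comm_quantale) ecat \<Rightarrow> bool" where
  "is_ecat \<A> \<longleftrightarrow>
     (\<forall>A\<in>Obj \<A>. \<forall>B\<in>Obj \<A>. is_vcat (Hom \<A> A B)) \<and>
     (\<forall>A\<in>Obj \<A>. Id \<A> A \<in> Arr \<A> A A) \<and>
     (\<forall>A\<in>Obj \<A>. \<forall>B\<in>Obj \<A>. \<forall>C\<in>Obj \<A>. \<forall>g\<in>Arr \<A> B C. \<forall>f\<in>Arr \<A> A B.
        Comp \<A> A B C g f \<in> Arr \<A> A C) \<and>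
     (\<forall>A\<in>Obj \<A>. \<forall>B\<in>Obj \<A>. \<forall>C\<in>Obj \<A>.
        \<forall>g\<in>Arr \<A> B C. \<forall>g'\<in>Arr \<A> B C. \<forall>f\<in>Arr \<A> A B. \<forall>f'\<in>Arr \<A> A B.
        vhom (Hom \<A> B C) g g' * vhom (Hom \<A> A B) f f' \<le>
          vhom (Hom \<A> A C) (Comp \<A> A B C g f) (Comp \<A> A B C g' f')) \<and>
     (\<forall>A\<in>Obj \<A>. \<forall>B\<in>Obj \<A>. \<forall>f\<in>Arr \<A> A B.
        Comp \<A> A B B (Id \<A> B) f = f \<and> Comp \<A> A A B f (Id \<A> A) = f) \<and>
     (\<forall>A\<in>Obj \<A>. \<forall>B\<in>Obj \<A>. \<forall>C\<in>Obj \<A>. \<forall>D\<in>Obj \<A>.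
        \<forall>h\<in>Arr \<A> C D. \<forall>g\<in>Arr \<A> B C. \<forall>f\<in>Arr \<A> A B.
        Comp \<A> A B D (Comp \<A> B C D h g) f = Comp \<A> A C D h (Comp \<A> A B C g f))"

record ('o, 'm, 'p, 'n) efun =
  on_ob :: "'o \<Rightarrow> 'p"
  on_arr :: "'o \<Rightarrow> 'o \<Rightarrow> 'm \<Rightarrow> 'n"

definition is_efun ::
    "('o, 'm, 'v::comm_quantale) ecat \<Rightarrow> ('p, 'n, 'v) ecat \<Rightarrow> ('o, 'm, 'p, 'n) efun \<Rightarrow> bool" where
  "is_efun \<A> \<B> F \<longleftrightarrow> is_ecat \<A> \<and> is_ecat \<B> \<and>
     (\<forall>A\<in>Obj \<A>. on_ob F A \<in> Obj \<B>) \<and>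
     (\<forall>A\<in>Obj \<A>. \<forall>B\<in>Obj \<A>. \<forall>f\<in>Arr \<A> A B.
        on_arr F A B f \<in> Arr \<B> (on_ob F A) (on_ob F B)) \<and>
     (\<forall>A\<in>Obj \<A>. \<forall>B\<in>Obj \<A>. \<forall>f\<in>Arr \<A> A B. \<forall>g\<in>Arr \<A> A B.
        vhom (Hom \<A> A B) f g \<le>
          vhom (Hom \<B> (on_ob F A) (on_ob F B)) (on_arr F A B f) (on_arr F A B g)) \<and>
     (\<forall>A\<in>Obj \<A>. on_arr F A A (Id \<A> A) = Id \<B> (on_ob F A)) \<and>
     (\<forall>A\<in>Obj \<A>. \<forall>B\<in>Obj \<A>. \<forall>C\<in>Obj \<A>. \<forall>g\<in>Arr \<A> B C. \<forall>f\<in>Arr \<A> A B.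
        on_arr F A C (Comp \<A> A B C g f) =
          Comp \<B> (on_ob F A) (on_ob F B) (on_ob F C) (on_arr F B C g) (on_arr F A B f))"

definition efun_id :: "('o, 'm, 'o, 'm) efun" where
  "efun_id = \<lparr>on_ob = (\<lambda>A. A), on_arr = (\<lambda>A B f. f)\<rparr>"

definition efun_comp ::
    "('p, 'n, 'q, 'k) efun \<Rightarrow> ('o, 'm, 'p, 'n) efun \<Rightarrow> ('o, 'm, 'q, 'k) efun"
    (infixl "\<circ>\<^sub>F" 55) where
  "G \<circ>\<^sub>F F =
     \<lparr>on_ob = (\<lambda>A. on_ob G (on_ob F A)),
      on_arr = (\<lambda>A B f. on_arr G (on_ob F A) (on_ob F B) (on_arr F A B f))\<rparr>"

definition efun_eq ::
    "('o, 'm, 'v) ecat \<Rightarrow> ('o, 'm, 'p, 'n) efun \<Rightarrow> ('o, 'm, 'p, 'n) efun \<Rightarrow> bool" where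
  "efun_eq \<A> F G \<longleftrightarrow>
     (\<forall>A\<in>Obj \<A>. on_ob F A = on_ob G A) \<and>
     (\<forall>A\<in>Obj \<A>. \<forall>B\<in>Obj \<A>. \<forall>f\<in>Arr \<A> A B. on_arr F A B f = on_arr G A B f)"

text \<open>Enriched naturality is an equation between \<open>\<V>\<close>-functors out of the homs of \<open>\<A>\<close>. As
  \<open>\<V>\<close>-functors are equal when they agree on objects, it is ordinary naturality.\<close>

definition is_enat ::
    "('o, 'm, 'v) ecat \<Rightarrow> ('p, 'n, 'v) ecat \<Rightarrow> ('o, 'm, 'p, 'n) efun \<Rightarrow> ('o, 'm, 'p, 'n) efun \<Rightarrow>
       ('o \<Rightarrow> 'n) \<Rightarrow> bool" where
  "is_enat \<A> \<B> F G \<eta> \<longleftrightarrow>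
     (\<forall>A\<in>Obj \<A>. \<eta> A \<in> Arr \<B> (on_ob F A) (on_ob G A)) \<and>
     (\<forall>A\<in>Obj \<A>. \<forall>B\<in>Obj \<A>. \<forall>f\<in>Arr \<A> A B.
        Comp \<B> (on_ob F A) (on_ob F B) (on_ob G B) (\<eta> B) (on_arr F A B f) =
        Comp \<B> (on_ob F A) (on_ob G A) (on_ob G B) (on_arr G A B f) (\<eta> A))"

text \<open>\<open>L : \<A> \<rightarrow> \<B>\<close> is left adjoint to \<open>R : \<B> \<rightarrow> \<A>\<close>, with unit \<open>\<eta>\<close> and counit \<open>\<epsilon>\<close>.\<close>

definition is_eadj ::
    "('o, 'm, 'v::comm_quantale) ecat \<Rightarrow> ('p, 'n, 'v) ecat \<Rightarrow>
       ('o, 'm, 'p, 'n) efun \<Rightarrow> ('p, 'n, 'o, 'm) efun \<Rightarrow> ('o \<Rightarrow> 'm) \<Rightarrow> ('p \<Rightarrow> 'n) \<Rightarrow> bool" where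
  "is_eadj \<A> \<B> L R \<eta> \<epsilon> \<longleftrightarrow>
     is_efun \<A> \<B> L \<and> is_efun \<B> \<A> R \<and>
     is_enat \<A> \<A> efun_id (R \<circ>\<^sub>F L) \<eta> \<and> is_enat \<B> \<B> (L \<circ>\<^sub>F R) efun_id \<epsilon> \<and>
     (\<forall>A\<in>Obj \<A>.
        let LA = on_ob L A; RLA = on_ob R LA; LRLA = on_ob L RLA in
        Comp \<B> LA LRLA LA (\<epsilon> LA) (on_arr L A RLA (\<eta> A)) = Id \<B> LA) \<and>
     (\<forall>B\<in>Obj \<B>.
        let RB = on_ob R B; LRB = on_ob L RB; RLRB = on_ob R LRB in
        Comp \<A> RB RLRB RB (on_arr R LRB B (\<epsilon> B)) (\<eta> RB) = Id \<A> RB)"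

text \<open>The adjunction \<open>L \<stileturn> R\<close> between \<open>\<A>\<close> and \<open>\<B>\<close> lifts along \<open>P : \<A>' \<rightarrow> \<A>\<close> and
  \<open>Q : \<B>' \<rightarrow> \<B>\<close>: there are adjoint functors \<open>L' : \<A>' \<rightarrow> \<B>'\<close> and \<open>R' : \<B>' \<rightarrow> \<A>'\<close> that commute
  strictly with \<open>P\<close> and \<open>Q\<close>, and whose unit and counit lie over those of \<open>L \<stileturn> R\<close>.\<close>

definition adjunction_lifts ::
    "('o, 'm, 'v::comm_quantale) ecat \<Rightarrow> ('p, 'n, 'v) ecat \<Rightarrow>
       ('o, 'm, 'p, 'n) efun \<Rightarrow> ('p, 'n, 'o, 'm) efun \<Rightarrow>
       ('o1, 'm1, 'v) ecat \<Rightarrow> ('p1, 'n1, 'v) ecat \<Rightarrow>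
       ('o1, 'm1, 'o, 'm) efun \<Rightarrow> ('p1, 'n1, 'p, 'n) efun \<Rightarrow> bool" where
  "adjunction_lifts \<A> \<B> L R \<A>' \<B>' P Q \<longleftrightarrow>
     (\<exists>\<eta> \<epsilon> L' R' \<eta>' \<epsilon>'.
        is_eadj \<A> \<B> L R \<eta> \<epsilon> \<and> is_eadj \<A>' \<B>' L' R' \<eta>' \<epsilon>' \<and>
        efun_eq \<A>' (Q \<circ>\<^sub>F L') (L \<circ>\<^sub>F P) \<and> efun_eq \<B>' (P \<circ>\<^sub>F R') (R \<circ>\<^sub>F Q) \<and>
        (\<forall>A\<in>Obj \<A>'. on_arr P A (on_ob R' (on_ob L' A)) (\<eta>' A) = \<eta> (on_ob P A)) \<and>
        (\<forall>B\<in>Obj \<B>'. on_arr Q (on_ob L' (on_ob R' B)) B (\<epsilon>' B) = \<epsilon> (on_ob Q B)))"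

text \<open>The \<open>\<V>\<close>-category \<open>[\<A>\<^sup>o\<^sup>p, \<V>-cat](\<C>(J-, X), \<B>(H-, Z))\<close> of natural families of
  \<open>\<V>\<close>-functors, for \<open>J : \<A> \<rightarrow> \<C>\<close> and \<open>H : \<A> \<rightarrow> \<B>\<close>.\<close>

definition is_cocone ::
    "('o, 'm, 'v::comm_quantale) ecat \<Rightarrow> ('p, 'n, 'v) ecat \<Rightarrow> ('q, 'k, 'v) ecat \<Rightarrow>
       ('o, 'm, 'p, 'n) efun \<Rightarrow> ('o, 'm, 'q, 'k) efun \<Rightarrow> 'p \<Rightarrow> 'q \<Rightarrow> ('o \<Rightarrow> 'n \<Rightarrow> 'k) \<Rightarrow> bool" where
  "is_cocone \<A> \<C> \<B> J H X Z \<alpha> \<longleftrightarrow>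
     \<alpha> \<in> extensional (Obj \<A>) \<and>
     (\<forall>S\<in>Obj \<A>. is_vfun (Hom \<C> (on_ob J S) X) (Hom \<B> (on_ob H S) Z) (\<alpha> S)) \<and>
     (\<forall>S\<in>Obj \<A>. \<forall>S'\<in>Obj \<A>. \<forall>u\<in>Arr \<A> S' S. \<forall>f\<in>Arr \<C> (on_ob J S) X.
        \<alpha> S' (Comp \<C> (on_ob J S') (on_ob J S) X f (on_arr J S' S u)) =
        Comp \<B> (on_ob H S') (on_ob H S) Z (\<alpha> S f) (on_arr H S' S u))"

definition cocone_cat ::
    "('o, 'm, 'v::comm_quantale) ecat \<Rightarrow> ('p, 'n, 'v) ecat \<Rightarrow> ('q, 'k, 'v) ecat \<Rightarrow>
       ('o, 'm, 'p, 'n) efun \<Rightarrow> ('o, 'm, 'q, 'k) efun \<Rightarrow> 'p \<Rightarrow> 'q \<Rightarrow> ('o \<Rightarrow> 'n \<Rightarrow> 'k, 'v) vcat" where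
  "cocone_cat \<A> \<C> \<B> J H X Z =
     \<lparr>vob = {\<alpha>. is_cocone \<A> \<C> \<B> J H X Z \<alpha>},
      vhom = (\<lambda>\<alpha> \<beta>. if is_cocone \<A> \<C> \<B> J H X Z \<alpha> \<and> is_cocone \<A> \<C> \<B> J H X Z \<beta>
        then INF S\<in>Obj \<A>. INF f\<in>Arr \<C> (on_ob J S) X.
               vhom (Hom \<B> (on_ob H S) Z) (\<alpha> S f) (\<beta> S f)
        else bot)\<rparr>"

text \<open>\<open>(L, \<eta>)\<close> is the left Kan extension of \<open>H\<close> along \<open>J\<close> in Kelly's (pointwise) sense:
  \<open>L X\<close> is the colimit of \<open>H\<close> weighted by \<open>\<C>(J-, X)\<close>. That is,
  \<open>\<B>(L X, Z) \<cong> [\<A>\<^sup>o\<^sup>p, \<V>-cat](\<C>(J-, X), \<B>(H-, Z))\<close>, by the map induced by \<open>L\<close> and the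
  unit \<open>\<eta> : H \<rightarrow> L J\<close>.\<close>

definition is_lan ::
    "('o, 'm, 'v::comm_quantale) ecat \<Rightarrow> ('p, 'n, 'v) ecat \<Rightarrow> ('q, 'k, 'v) ecat \<Rightarrow>
       ('o, 'm, 'p, 'n) efun \<Rightarrow> ('o, 'm, 'q, 'k) efun \<Rightarrow>
       ('p, 'n, 'q, 'k) efun \<Rightarrow> ('o \<Rightarrow> 'k) \<Rightarrow> bool" where
  "is_lan \<A> \<C> \<B> J H L \<eta> \<longleftrightarrow>
     is_efun \<A> \<C> J \<and> is_efun \<A> \<B> H \<and> is_efun \<C> \<B> L \<and> is_enat \<A> \<B> H (L \<circ>\<^sub>F J) \<eta> \<and>
     (\<forall>X\<in>Obj \<C>. \<forall>Z\<in>Obj \<B>.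
        is_viso (Hom \<B> (on_ob L X) Z) (cocone_cat \<A> \<C> \<B> J H X Z)
          (\<lambda>k. \<lambda>S\<in>Obj \<A>. \<lambda>f\<in>Arr \<C> (on_ob J S) X.
             Comp \<B> (on_ob H S) (on_ob L X) Z k
               (Comp \<B> (on_ob H S) (on_ob L (on_ob J S)) (on_ob L X)
                  (on_arr L (on_ob J S) X f) (\<eta> S))))"

definition Coalg ::
    "('o, 'm, 'v::comm_quantale) ecat \<Rightarrow> ('o, 'm, 'o, 'm) efun \<Rightarrow> ('o \<times> 'm, 'm, 'v) ecat" where
  "Coalg \<X> S =
     \<lparr>Obj = {(X, c). X \<in> Obj \<X> \<and> c \<in> Arr \<X> X (on_ob S X)},
      Hom = (\<lambda>(X, c) (Y, d). full_sub (Hom \<X> X Y)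
        (\<lambda>f. Comp \<X> X Y (on_ob S Y) d f =
             Comp \<X> X (on_ob S X) (on_ob S Y) (on_arr S X Y f) c)),
      Id = (\<lambda>(X, c). Id \<X> X),
      Comp = (\<lambda>(X, c) (Y, d) (Z, b). Comp \<X> X Y Z)\<rparr>"

definition forget :: "('o \<times> 'm, 'm, 'o, 'm) efun" where
  "forget = \<lparr>on_ob = fst, on_arr = (\<lambda>A B f. f)\<rparr>"

section \<open>Sets, preorders and \<open>\<V>\<close>-categories\<close>

text \<open>\<open>U\<close> is the collection of small sets: the elements of a Grothendieck universe, or all
  subsets of the type \<open>'u\<close>. The only closure property ever needed is closure under subsets,
  so that \<open>C\<close> lands in small sets. Maps are extensional functions.\<close>

definition SetE :: "'u set set \<Rightarrow> ('u set, 'u \<Rightarrow> 'u, 'v::comm_quantale) ecat" where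
  "SetE U =
     \<lparr>Obj = U,
      Hom = (\<lambda>A B. d_star (discrete_preord (A \<rightarrow>\<^sub>E B))),
      Id = (\<lambda>A. \<lambda>x\<in>A. x),
      Comp = (\<lambda>A B C g f. compose A g f)\<rparr>"

definition VCat :: "'u set set \<Rightarrow> (('u, 'v) vcat, 'u \<Rightarrow> 'u, 'v::comm_quantale) ecat" where
  "VCat U =
     \<lparr>Obj = {X. is_vcat X \<and> vob X \<in> U},
      Hom = vfun_cat,
      Id = (\<lambda>X. \<lambda>x\<in>vob X. x),
      Comp = (\<lambda>X Y Z g f. compose (vob X) g f)\<rparr>"

text \<open>A \<open>Preord\<close>-enriched category as a \<open>\<V>\<close>-cat-enriched one, by applying \<^const>\<open>d_star\<close> to its
  homs.\<close>

definition change_base :: "('o, 'm, bool) ecat \<Rightarrow> ('o, 'm, 'v::comm_quantale) ecat" where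
  "change_base \<A> =
     \<lparr>Obj = Obj \<A>, Hom = (\<lambda>A B. d_star (Hom \<A> A B)), Id = Id \<A>, Comp = Comp \<A>\<rparr>"

definition PreordE :: "'u set set \<Rightarrow> (('u, bool) vcat, 'u \<Rightarrow> 'u, 'v::comm_quantale) ecat" where
  "PreordE U = change_base (VCat U)"

definition D_fun :: "('u set, 'u \<Rightarrow> 'u, ('u, bool) vcat, 'u \<Rightarrow> 'u) efun" where
  "D_fun = \<lparr>on_ob = discrete_preord, on_arr = (\<lambda>A B f. f)\<rparr>"

definition C_fun :: "(('u, bool) vcat, 'u \<Rightarrow> 'u, 'u set, 'u \<Rightarrow> 'u) efun" where
  "C_fun =
     \<lparr>on_ob = (\<lambda>X. component X ` vob X),
      on_arr = (\<lambda>X Y f. \<lambda>a\<in>component X ` vob X. component Y (f a))\<rparr>"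

definition d_fun ::
    "(('u, bool) vcat, 'u \<Rightarrow> 'u, ('u, 'v::comm_quantale) vcat, 'u \<Rightarrow> 'u) efun" where
  "d_fun = \<lparr>on_ob = d_star, on_arr = (\<lambda>X Y f. f)\<rparr>"

definition c_fun ::
    "(('u, 'v::comm_quantale) vcat, 'u \<Rightarrow> 'u, ('u, bool) vcat, 'u \<Rightarrow> 'u) efun" where
  "c_fun = \<lparr>on_ob = c_star, on_arr = (\<lambda>X Y f. f)\<rparr>"

definition DV_fun :: "('u set, 'u \<Rightarrow> 'u, ('u, 'v::comm_quantale) vcat, 'u \<Rightarrow> 'u) efun" where
  "DV_fun = d_fun \<circ>\<^sub>F D_fun"

definition set_endofunctor :: "'u set set \<Rightarrow> ('u set, 'u \<Rightarrow> 'u, 'u set, 'u \<Rightarrow> 'u) efun \<Rightarrow> bool" where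
  "set_endofunctor U T \<longleftrightarrow>
     (\<forall>A\<in>U. on_ob T A \<in> U) \<and>
     (\<forall>A\<in>U. \<forall>B\<in>U. \<forall>f\<in>A \<rightarrow>\<^sub>E B. on_arr T A B f \<in> on_ob T A \<rightarrow>\<^sub>E on_ob T B) \<and>
     (\<forall>A\<in>U. on_arr T A A (\<lambda>x\<in>A. x) = (\<lambda>x\<in>on_ob T A. x)) \<and>
     (\<forall>A\<in>U. \<forall>B\<in>U. \<forall>C\<in>U. \<forall>g\<in>B \<rightarrow>\<^sub>E C. \<forall>f\<in>A \<rightarrow>\<^sub>E B.
        on_arr T A C (compose A g f) = compose (on_ob T A) (on_arr T B C g) (on_arr T A B f))"

text \<open>\<open>S\<close> is the left Kan extension of \<open>D\<^sup>\<V> T\<close> along \<open>D\<^sup>\<V>\<close>. For \<open>'v = bool\<close> this is the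
  \<open>Preord\<close>-ification of \<open>T\<close>.\<close>

definition is_vcatification ::
    "'u set set \<Rightarrow> ('u set, 'u \<Rightarrow> 'u, 'u set, 'u \<Rightarrow> 'u) efun \<Rightarrow>
       (('u, 'v::comm_quantale) vcat, 'u \<Rightarrow> 'u, ('u, 'v) vcat, 'u \<Rightarrow> 'u) efun \<Rightarrow> bool" where
  "is_vcatification U T S \<longleftrightarrow>
     (\<exists>\<eta>. is_lan (SetE U) (VCat U) (VCat U) DV_fun (DV_fun \<circ>\<^sub>F T) S \<eta>)"

end

theory Submission imports Defs begin

text \<open>An adjunction \<open>L \<stileturn> R\<close> lifts to coalgebras for \<open>S\<close> and \<open>T\<close> as soon as \<open>R T\<close> and \<open>S R\<close> are
  naturally isomorphic: \<open>R\<close> lifts along \<open>\<phi> : R T \<rightarrow> S R\<close>, \<open>L\<close> lifts along the mate \<open>L S \<rightarrow> T L\<close> of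
  \<open>\<phi>\<^sup>-\<^sup>1\<close>, and unit and counit are then coalgebra morphisms.

  For \<open>C \<stileturn> D\<close> the isomorphism \<open>D T \<cong> T\<^sub>2 D\<close> is the unit of the left Kan extension, which is
  invertible because \<open>D\<close> is fully faithful. For \<open>c\<^sub>* \<stileturn> d\<^sub>*\<close> the isomorphism \<open>d\<^sub>* T\<^sub>2 \<cong> T\<^sub>\<V> d\<^sub>*\<close>
  holds because \<open>d\<^sub>*\<close> is also a left adjoint: its right adjoint sends \<open>Z\<close> to the preorder
  \<open>e \<le> Z(x', x)\<close>, so \<open>d\<^sub>*\<close> preserves the colimit that defines \<open>T\<^sub>2 X\<close>, and \<open>d\<^sub>*\<close> being fully faithful,
  the weight of that colimit is the one for \<open>T\<^sub>\<V> (d\<^sub>* X)\<close>.\<close>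

section \<open>Order properties of the tensor\<close>

lemma times_left_mono: "a \<le> b \<Longrightarrow> a * c \<le> b * (c :: 'v::comm_quantale)"
  by (meson order.trans order.refl qhom_adjoint)

lemma times_mono: "a \<le> b \<Longrightarrow> c \<le> d \<Longrightarrow> a * c \<le> b * (d :: 'v::comm_quantale)"
  by (metis mult.commute order.trans times_left_mono)

text \<open>Multiplication by \<open>r\<close> is a left adjoint, so it preserves the least
  element.\<close>

lemma bot_times [simp]: "bot * r = (bot :: 'v::comm_quantale)" "r * bot = (bot :: 'v::comm_quantale)"
proof -
  have "bot * r \<le> bot" for r :: 'v by (subst qhom_adjoint) simp
  then show "bot * r = bot" by (simp add: bot_unique)
  then show "r * bot = bot" by (simp add: mult.commute)
qed

section \<open>Lifting adjunctions to coalgebras\<close>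

locale ecategory =
  fixes \<A> :: "('o, 'm, 'v::comm_quantale) ecat"
  assumes ecat: "is_ecat \<A>"
begin

lemma hom_vcat: "X \<in> Obj \<A> \<Longrightarrow> Y \<in> Obj \<A> \<Longrightarrow> is_vcat (Hom \<A> X Y)"
  using ecat by (simp add: is_ecat_def)

lemma id_in [simp]: "X \<in> Obj \<A> \<Longrightarrow> Id \<A> X \<in> Arr \<A> X X"
  using ecat by (simp add: is_ecat_def)

lemma comp_in [simp]:
  "\<lbrakk>X \<in> Obj \<A>; Y \<in> Obj \<A>; Z \<in> Obj \<A>; g \<in> Arr \<A> Y Z; f \<in> Arr \<A> X Y\<rbrakk>
    \<Longrightarrow> Comp \<A> X Y Z g f \<in> Arr \<A> X Z"
  using ecat by (simp add: is_ecat_def)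

lemma comp_mono:
  "\<lbrakk>X \<in> Obj \<A>; Y \<in> Obj \<A>; Z \<in> Obj \<A>; g \<in> Arr \<A> Y Z; g' \<in> Arr \<A> Y Z; f \<in> Arr \<A> X Y; f' \<in> Arr \<A> X Y\<rbrakk>
    \<Longrightarrow> vhom (Hom \<A> Y Z) g g' * vhom (Hom \<A> X Y) f f'
      \<le> vhom (Hom \<A> X Z) (Comp \<A> X Y Z g f) (Comp \<A> X Y Z g' f')"
  using ecat unfolding is_ecat_def by blast

lemma id_comp [simp]:
  "\<lbrakk>X \<in> Obj \<A>; Y \<in> Obj \<A>; f \<in> Arr \<A> X Y\<rbrakk> \<Longrightarrow> Comp \<A> X Y Y (Id \<A> Y) f = f"
  using ecat unfolding is_ecat_def by blast

lemma comp_id [simp]: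
  "\<lbrakk>X \<in> Obj \<A>; Y \<in> Obj \<A>; f \<in> Arr \<A> X Y\<rbrakk> \<Longrightarrow> Comp \<A> X X Y f (Id \<A> X) = f"
  using ecat unfolding is_ecat_def by blast

lemma assoc:
  "\<lbrakk>W \<in> Obj \<A>; X \<in> Obj \<A>; Y \<in> Obj \<A>; Z \<in> Obj \<A>;
    h \<in> Arr \<A> Y Z; g \<in> Arr \<A> X Y; f \<in> Arr \<A> W X\<rbrakk>
    \<Longrightarrow> Comp \<A> W X Z (Comp \<A> X Y Z h g) f = Comp \<A> W Y Z h (Comp \<A> W X Y g f)"
  using ecat unfolding is_ecat_def by blast

end

locale efunctor =
  fixes \<A> :: "('o, 'm, 'v::comm_quantale) ecat" and \<B> :: "('p, 'n, 'v) ecat"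
    and F :: "('o, 'm, 'p, 'n) efun"
  assumes efun: "is_efun \<A> \<B> F"
begin

sublocale dom: ecategory \<A>
  using efun by unfold_locales (simp add: is_efun_def)

sublocale cod: ecategory \<B>
  using efun by unfold_locales (simp add: is_efun_def)

lemma ob_in [simp]: "X \<in> Obj \<A> \<Longrightarrow> on_ob F X \<in> Obj \<B>"
  using efun unfolding is_efun_def by blast

lemma arr_in [simp]:
  "\<lbrakk>X \<in> Obj \<A>; Y \<in> Obj \<A>; f \<in> Arr \<A> X Y\<rbrakk> \<Longrightarrow> on_arr F X Y f \<in> Arr \<B> (on_ob F X) (on_ob F Y)"
  using efun unfolding is_efun_def by blast

lemma arr_mono:
  "\<lbrakk>X \<in> Obj \<A>; Y \<in> Obj \<A>; f \<in> Arr \<A> X Y; g \<in> Arr \<A> X Y\<rbrakk> \<Longrightarrow>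
    vhom (Hom \<A> X Y) f g
      \<le> vhom (Hom \<B> (on_ob F X) (on_ob F Y)) (on_arr F X Y f) (on_arr F X Y g)"
  using efun unfolding is_efun_def by blast

lemma arr_id [simp]: "X \<in> Obj \<A> \<Longrightarrow> on_arr F X X (Id \<A> X) = Id \<B> (on_ob F X)"
  using efun unfolding is_efun_def by blast

lemma arr_comp [simp]:
  "\<lbrakk>X \<in> Obj \<A>; Y \<in> Obj \<A>; Z \<in> Obj \<A>; g \<in> Arr \<A> Y Z; f \<in> Arr \<A> X Y\<rbrakk> \<Longrightarrow>
    on_arr F X Z (Comp \<A> X Y Z g f)
      = Comp \<B> (on_ob F X) (on_ob F Y) (on_ob F Z) (on_arr F Y Z g) (on_arr F X Y f)"
  using efun unfolding is_efun_def by blast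

end

lemma efun_comp_simps [simp]:
  "on_ob (G \<circ>\<^sub>F F) X = on_ob G (on_ob F X)"
  "on_arr (G \<circ>\<^sub>F F) X Y f = on_arr G (on_ob F X) (on_ob F Y) (on_arr F X Y f)"
  by (simp_all add: efun_comp_def)

lemma efun_id_simps [simp]: "on_ob efun_id X = X" "on_arr efun_id X Y f = f"
  by (simp_all add: efun_id_def)

lemma forget_simps [simp]: "on_ob forget P = fst P" "on_arr forget P Q f = f"
  by (simp_all add: forget_def)

lemma is_efun_comp:
  assumes "is_efun \<A> \<B> F" "is_efun \<B> \<C> G"
  shows "is_efun \<A> \<C> (G \<circ>\<^sub>F F)"
proof -
  interpret F: efunctor \<A> \<B> F using assms by (simp add: efunctor_def)
  interpret G: efunctor \<B> \<C> G using assms by (simp add: efunctor_def)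
  have "vhom (Hom \<A> A B) f g \<le> vhom (Hom \<C> (on_ob G (on_ob F A)) (on_ob G (on_ob F B)))
      (on_arr G (on_ob F A) (on_ob F B) (on_arr F A B f)) (on_arr G (on_ob F A) (on_ob F B) (on_arr F A B g))"
    if "A \<in> Obj \<A>" "B \<in> Obj \<A>" "f \<in> Arr \<A> A B" "g \<in> Arr \<A> A B" for A B f g
    using F.arr_mono[OF that] G.arr_mono[of "on_ob F A" "on_ob F B" "on_arr F A B f" "on_arr F A B g"] that
    by simp
  then show ?thesis
    by (simp add: is_efun_def F.dom.ecat G.cod.ecat)
qed

section \<open>The enriched category of coalgebras\<close>

lemma is_vcat_full_sub: "is_vcat X \<Longrightarrow> is_vcat (full_sub X P)"
  by (auto simp: is_vcat_def full_sub_def)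

context
  fixes \<X> :: "('o, 'm, 'v::comm_quantale) ecat" and S :: "('o, 'm, 'o, 'm) efun"
begin

lemma Coalg_Obj [simp]:
  "(X, c) \<in> Obj (Coalg \<X> S) \<longleftrightarrow> X \<in> Obj \<X> \<and> c \<in> Arr \<X> X (on_ob S X)"
  by (simp add: Coalg_def)

lemma Coalg_Arr [simp]:
  "f \<in> Arr (Coalg \<X> S) (X, c) (Y, d) \<longleftrightarrow> f \<in> Arr \<X> X Y \<and>
     Comp \<X> X Y (on_ob S Y) d f = Comp \<X> X (on_ob S X) (on_ob S Y) (on_arr S X Y f) c"
  by (simp add: Coalg_def full_sub_def)

lemma Coalg_vhom [simp]:
  "\<lbrakk>f \<in> Arr (Coalg \<X> S) (X, c) (Y, d); g \<in> Arr (Coalg \<X> S) (X, c) (Y, d)\<rbrakk>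
    \<Longrightarrow> vhom (Hom (Coalg \<X> S) (X, c) (Y, d)) f g = vhom (Hom \<X> X Y) f g"
  by (simp add: Coalg_def full_sub_def)

lemma Coalg_Id [simp]: "Id (Coalg \<X> S) (X, c) = Id \<X> X"
  by (simp add: Coalg_def)

lemma Coalg_Comp [simp]: "Comp (Coalg \<X> S) (X, c) (Y, d) (Z, e) = Comp \<X> X Y Z"
  by (simp add: Coalg_def)

end

text \<open>Pasting two coalgebra squares gives closure under composition. Homs are full in those of
  \<open>\<X>\<close>, so the remaining laws are inherited.\<close>

lemma is_ecat_Coalg:
  assumes "is_efun \<X> \<X> S"
  shows "is_ecat (Coalg \<X> S)"
proof -
  interpret S: efunctor \<X> \<X> S using assms by (simp add: efunctor_def)
  have comp: "Comp \<X> X Y Z g f \<in> Arr (Coalg \<X> S) (X, c) (Z, e)"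
    if P: "(X, c) \<in> Obj (Coalg \<X> S)" "(Y, d) \<in> Obj (Coalg \<X> S)" "(Z, e) \<in> Obj (Coalg \<X> S)"
      and g: "g \<in> Arr (Coalg \<X> S) (Y, d) (Z, e)" and f: "f \<in> Arr (Coalg \<X> S) (X, c) (Y, d)"
    for X c Y d Z e f g
  proof -
    have mem: "X \<in> Obj \<X>" "Y \<in> Obj \<X>" "Z \<in> Obj \<X>" "g \<in> Arr \<X> Y Z" "f \<in> Arr \<X> X Y"
      "e \<in> Arr \<X> Z (on_ob S Z)"
      using P g f by auto
    have "Comp \<X> X Z (on_ob S Z) e (Comp \<X> X Y Z g f)
        = Comp \<X> X Y (on_ob S Z) (Comp \<X> Y Z (on_ob S Z) e g) f"
      using mem by (simp add: S.dom.assoc)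
    also have "\<dots> = Comp \<X> X (on_ob S Y) (on_ob S Z) (on_arr S Y Z g) (Comp \<X> X Y (on_ob S Y) d f)"
      using P g f by (simp add: S.dom.assoc)
    also have "\<dots> = Comp \<X> X (on_ob S X) (on_ob S Z) (on_arr S X Z (Comp \<X> X Y Z g f)) c"
      using P g f by (simp add: S.dom.assoc)
    finally show ?thesis using P g f by simp
  qed
  have vcat: "is_vcat (Hom (Coalg \<X> S) P Q)"
    if "P \<in> Obj (Coalg \<X> S)" "Q \<in> Obj (Coalg \<X> S)" for P Q
    using that by (cases P; cases Q) (simp add: Coalg_def is_vcat_full_sub S.dom.hom_vcat)
  show ?thesis
    unfolding is_ecat_def
  proof (intro conjI ballI)
    fix P Q assume "P \<in> Obj (Coalg \<X> S)" "Q \<in> Obj (Coalg \<X> S)"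
    then show "is_vcat (Hom (Coalg \<X> S) P Q)" by (rule vcat)
  next
    fix P assume "P \<in> Obj (Coalg \<X> S)"
    then show "Id (Coalg \<X> S) P \<in> Arr (Coalg \<X> S) P P" by (cases P) simp
  next
    fix P Q R g f
    assume "P \<in> Obj (Coalg \<X> S)" "Q \<in> Obj (Coalg \<X> S)" "R \<in> Obj (Coalg \<X> S)"
      "g \<in> Arr (Coalg \<X> S) Q R" "f \<in> Arr (Coalg \<X> S) P Q"
    then show "Comp (Coalg \<X> S) P Q R g f \<in> Arr (Coalg \<X> S) P R"
      by (cases P; cases Q; cases R) (metis Coalg_Comp comp)
  next
    fix P Q R g g' f f'
    assume A: "P \<in> Obj (Coalg \<X> S)" "Q \<in> Obj (Coalg \<X> S)" "R \<in> Obj (Coalg \<X> S)"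
      "g \<in> Arr (Coalg \<X> S) Q R" "g' \<in> Arr (Coalg \<X> S) Q R"
      "f \<in> Arr (Coalg \<X> S) P Q" "f' \<in> Arr (Coalg \<X> S) P Q"
    obtain X c Y d Z e where [simp]: "P = (X, c)" "Q = (Y, d)" "R = (Z, e)"
      by (metis surj_pair)
    \<comment> \<open>\<open>full_sub\<close> sends homs between non-members to \<open>bot\<close>,
      so the inequality requires both composites to be coalgebra morphisms.\<close>
    have "Comp \<X> X Y Z g f \<in> Arr (Coalg \<X> S) (X, c) (Z, e)"
      "Comp \<X> X Y Z g' f' \<in> Arr (Coalg \<X> S) (X, c) (Z, e)"
      using A comp by auto
    then show "vhom (Hom (Coalg \<X> S) Q R) g g' * vhom (Hom (Coalg \<X> S) P Q) f f'
      \<le> vhom (Hom (Coalg \<X> S) P R) (Comp (Coalg \<X> S) P Q R g f) (Comp (Coalg \<X> S) P Q R g' f')"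
      using A by (simp del: Coalg_Arr) (simp add: S.dom.comp_mono)
  next
    fix P Q f
    assume "P \<in> Obj (Coalg \<X> S)" "Q \<in> Obj (Coalg \<X> S)" "f \<in> Arr (Coalg \<X> S) P Q"
    then show "Comp (Coalg \<X> S) P Q Q (Id (Coalg \<X> S) Q) f = f"
      "Comp (Coalg \<X> S) P P Q f (Id (Coalg \<X> S) P) = f"
      by (cases P; cases Q; simp)+
  next
    fix P Q R W h g f
    assume "P \<in> Obj (Coalg \<X> S)" "Q \<in> Obj (Coalg \<X> S)" "R \<in> Obj (Coalg \<X> S)"
      "W \<in> Obj (Coalg \<X> S)" "h \<in> Arr (Coalg \<X> S) R W"
      "g \<in> Arr (Coalg \<X> S) Q R" "f \<in> Arr (Coalg \<X> S) P Q"
    then show "Comp (Coalg \<X> S) P Q W (Comp (Coalg \<X> S) Q R W h g) f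
        = Comp (Coalg \<X> S) P R W h (Comp (Coalg \<X> S) P Q R g f)"
      by (cases P; cases Q; cases R; cases W) (simp add: S.dom.assoc)
  qed
qed

text \<open>A structure map \<open>c\<close> goes to \<open>F c\<close> followed by
  \<open>\<delta> X\<close>; naturality of \<open>\<delta>\<close> makes \<open>F f\<close> a
  morphism for the new structures. Both adjoints are lifted this way, the left one along
  \<open>\<delta>\<close> and the right one along \<open>\<phi>\<close>.\<close>

lemma is_efun_Coalg_lift:
  assumes F: "is_efun \<A> \<B> F" and S: "is_efun \<A> \<A> S" and T: "is_efun \<B> \<B> T"
    and \<delta>: "is_enat \<A> \<B> (F \<circ>\<^sub>F S) (T \<circ>\<^sub>F F) \<delta>"
  shows "is_efun (Coalg \<A> S) (Coalg \<B> T)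
    \<lparr>on_ob = \<lambda>(X, c). (on_ob F X, Comp \<B> (on_ob F X) (on_ob F (on_ob S X)) (on_ob T (on_ob F X))
        (\<delta> X) (on_arr F X (on_ob S X) c)),
     on_arr = \<lambda>P Q. on_arr F (fst P) (fst Q)\<rparr>"
    (is "is_efun _ _ ?F")
proof -
  interpret F: efunctor \<A> \<B> F using F by (simp add: efunctor_def)
  interpret S: efunctor \<A> \<A> S using S by (simp add: efunctor_def)
  interpret T: efunctor \<B> \<B> T using T by (simp add: efunctor_def)
  have \<delta>_in [simp]: "\<delta> X \<in> Arr \<B> (on_ob F (on_ob S X)) (on_ob T (on_ob F X))" if "X \<in> Obj \<A>" for X
    using \<delta> that by (simp add: is_enat_def)
  have \<delta>_nat: "Comp \<B> (on_ob F (on_ob S X)) (on_ob F (on_ob S Y)) (on_ob T (on_ob F Y)) (\<delta> Y)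
        (on_arr F (on_ob S X) (on_ob S Y) (on_arr S X Y f))
      = Comp \<B> (on_ob F (on_ob S X)) (on_ob T (on_ob F X)) (on_ob T (on_ob F Y))
        (on_arr T (on_ob F X) (on_ob F Y) (on_arr F X Y f)) (\<delta> X)"
    if "X \<in> Obj \<A>" "Y \<in> Obj \<A>" "f \<in> Arr \<A> X Y" for X Y f
    using \<delta> that by (simp add: is_enat_def)
  have arr: "on_arr F X Y f \<in> Arr (Coalg \<B> T) (on_ob ?F (X, c)) (on_ob ?F (Y, d))"
    if P: "(X, c) \<in> Obj (Coalg \<A> S)" "(Y, d) \<in> Obj (Coalg \<A> S)"
      and f: "f \<in> Arr (Coalg \<A> S) (X, c) (Y, d)" for X c Y d f
  proof -
    let ?FX = "on_ob F X" and ?FY = "on_ob F Y" and ?FSX = "on_ob F (on_ob S X)"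
      and ?FSY = "on_ob F (on_ob S Y)" and ?TFX = "on_ob T (on_ob F X)" and ?TFY = "on_ob T (on_ob F Y)"
    have mem: "X \<in> Obj \<A>" "Y \<in> Obj \<A>" "f \<in> Arr \<A> X Y" "d \<in> Arr \<A> Y (on_ob S Y)"
      using P f by auto
    have "Comp \<B> ?FX ?FY ?TFY (Comp \<B> ?FY ?FSY ?TFY (\<delta> Y) (on_arr F Y (on_ob S Y) d)) (on_arr F X Y f)
        = Comp \<B> ?FX ?FSY ?TFY (\<delta> Y) (on_arr F X (on_ob S Y) (Comp \<A> X Y (on_ob S Y) d f))"
      using mem by (simp add: F.cod.assoc)
    also have "\<dots> = Comp \<B> ?FX ?FSY ?TFY (\<delta> Y)
        (on_arr F X (on_ob S Y) (Comp \<A> X (on_ob S X) (on_ob S Y) (on_arr S X Y f) c))"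
      using f by simp
    also have "\<dots> = Comp \<B> ?FX ?FSX ?TFY (Comp \<B> ?FSX ?FSY ?TFY (\<delta> Y)
        (on_arr F (on_ob S X) (on_ob S Y) (on_arr S X Y f))) (on_arr F X (on_ob S X) c)"
      using P f by (simp add: F.cod.assoc)
    also have "\<dots> = Comp \<B> ?FX ?TFX ?TFY (on_arr T ?FX ?FY (on_arr F X Y f))
        (Comp \<B> ?FX ?FSX ?TFX (\<delta> X) (on_arr F X (on_ob S X) c))"
      using P f by (simp add: F.cod.assoc \<delta>_nat)
    finally show ?thesis using P f by simp
  qed
  show ?thesis
    unfolding is_efun_def
  proof (intro conjI ballI)
    show "is_ecat (Coalg \<A> S)" "is_ecat (Coalg \<B> T)" using S T is_ecat_Coalg by auto
  next
    fix P assume "P \<in> Obj (Coalg \<A> S)"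
    then show "on_ob ?F P \<in> Obj (Coalg \<B> T)" by (cases P) simp
  next
    fix P Q f assume "P \<in> Obj (Coalg \<A> S)" "Q \<in> Obj (Coalg \<A> S)" "f \<in> Arr (Coalg \<A> S) P Q"
    then show "on_arr ?F P Q f \<in> Arr (Coalg \<B> T) (on_ob ?F P) (on_ob ?F Q)"
      using arr by (cases P; cases Q) (simp del: Coalg_Obj Coalg_Arr)
  next
    fix P Q f g
    assume A: "P \<in> Obj (Coalg \<A> S)" "Q \<in> Obj (Coalg \<A> S)"
      "f \<in> Arr (Coalg \<A> S) P Q" "g \<in> Arr (Coalg \<A> S) P Q"
    obtain X c Y d where [simp]: "P = (X, c)" "Q = (Y, d)"
      by (metis surj_pair)
    have "on_arr F X Y f \<in> Arr (Coalg \<B> T) (on_ob ?F P) (on_ob ?F Q)"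
      "on_arr F X Y g \<in> Arr (Coalg \<B> T) (on_ob ?F P) (on_ob ?F Q)"
      using A arr by auto
    then show "vhom (Hom (Coalg \<A> S) P Q) f g
      \<le> vhom (Hom (Coalg \<B> T) (on_ob ?F P) (on_ob ?F Q)) (on_arr ?F P Q f) (on_arr ?F P Q g)"
      using A by (simp del: Coalg_Arr) (simp add: F.arr_mono)
  next
    fix P assume "P \<in> Obj (Coalg \<A> S)"
    then show "on_arr ?F P P (Id (Coalg \<A> S) P) = Id (Coalg \<B> T) (on_ob ?F P)"
      by (cases P) simp
  next
    fix P Q R g f
    assume "P \<in> Obj (Coalg \<A> S)" "Q \<in> Obj (Coalg \<A> S)" "R \<in> Obj (Coalg \<A> S)"
      "g \<in> Arr (Coalg \<A> S) Q R" "f \<in> Arr (Coalg \<A> S) P Q"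
    then show "on_arr ?F P R (Comp (Coalg \<A> S) P Q R g f)
      = Comp (Coalg \<B> T) (on_ob ?F P) (on_ob ?F Q) (on_ob ?F R) (on_arr ?F Q R g) (on_arr ?F P Q f)"
      by (cases P; cases Q; cases R) simp
  qed
qed

text \<open>The conditions \<open>unit\<close> and \<open>counit\<close> are the compatibilities of
  \<open>\<delta>\<close> and \<open>\<phi>\<close> that turn \<open>\<eta>\<close> and
  \<open>\<epsilon>\<close> into coalgebra morphisms for every structure map.\<close>

lemma is_eadj_Coalg_lift:
  assumes adj: "is_eadj \<A> \<B> L R \<eta> \<epsilon>" and S: "is_efun \<A> \<A> S" and T: "is_efun \<B> \<B> T"
    and \<delta>: "is_enat \<A> \<B> (L \<circ>\<^sub>F S) (T \<circ>\<^sub>F L) \<delta>" and \<phi>: "is_enat \<B> \<A> (R \<circ>\<^sub>F T) (S \<circ>\<^sub>F R) \<phi>"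
    and unit: "\<And>X. X \<in> Obj \<A> \<Longrightarrow>
      Comp \<A> (on_ob S X) (on_ob R (on_ob T (on_ob L X))) (on_ob S (on_ob R (on_ob L X)))
        (\<phi> (on_ob L X))
        (Comp \<A> (on_ob S X) (on_ob R (on_ob L (on_ob S X))) (on_ob R (on_ob T (on_ob L X)))
          (on_arr R (on_ob L (on_ob S X)) (on_ob T (on_ob L X)) (\<delta> X)) (\<eta> (on_ob S X)))
      = on_arr S X (on_ob R (on_ob L X)) (\<eta> X)"
    and counit: "\<And>Y. Y \<in> Obj \<B> \<Longrightarrow>
      Comp \<B> (on_ob L (on_ob R (on_ob T Y))) (on_ob T (on_ob L (on_ob R Y))) (on_ob T Y)
        (on_arr T (on_ob L (on_ob R Y)) Y (\<epsilon> Y))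
        (Comp \<B> (on_ob L (on_ob R (on_ob T Y))) (on_ob L (on_ob S (on_ob R Y))) (on_ob T (on_ob L (on_ob R Y)))
          (\<delta> (on_ob R Y)) (on_arr L (on_ob R (on_ob T Y)) (on_ob S (on_ob R Y)) (\<phi> Y)))
      = \<epsilon> (on_ob T Y)"
  shows "adjunction_lifts \<A> \<B> L R (Coalg \<A> S) (Coalg \<B> T) forget forget"
proof -
  have L: "is_efun \<A> \<B> L" and R: "is_efun \<B> \<A> R"
    using adj by (simp_all add: is_eadj_def)
  interpret L: efunctor \<A> \<B> L using L by (simp add: efunctor_def)
  interpret R: efunctor \<B> \<A> R using R by (simp add: efunctor_def)
  interpret S: efunctor \<A> \<A> S using S by (simp add: efunctor_def)
  interpret T: efunctor \<B> \<B> T using T by (simp add: efunctor_def)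
  let ?c' = "\<lambda>X c. Comp \<B> (on_ob L X) (on_ob L (on_ob S X)) (on_ob T (on_ob L X))
    (\<delta> X) (on_arr L X (on_ob S X) c)"
  let ?d' = "\<lambda>Y d. Comp \<A> (on_ob R Y) (on_ob R (on_ob T Y)) (on_ob S (on_ob R Y))
    (\<phi> Y) (on_arr R Y (on_ob T Y) d)"
  let ?L = "\<lparr>on_ob = \<lambda>(X, c). (on_ob L X, ?c' X c), on_arr = \<lambda>P Q. on_arr L (fst P) (fst Q)\<rparr>"
  let ?R = "\<lparr>on_ob = \<lambda>(Y, d). (on_ob R Y, ?d' Y d), on_arr = \<lambda>P Q. on_arr R (fst P) (fst Q)\<rparr>"
  let ?CA = "Coalg \<A> S" and ?CB = "Coalg \<B> T"
  have L': "is_efun ?CA ?CB ?L" using L S T \<delta> by (rule is_efun_Coalg_lift)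
  have R': "is_efun ?CB ?CA ?R" using R T S \<phi> by (rule is_efun_Coalg_lift)
  have \<delta>_in [simp]: "\<delta> X \<in> Arr \<B> (on_ob L (on_ob S X)) (on_ob T (on_ob L X))" if "X \<in> Obj \<A>" for X
    using \<delta> that by (simp add: is_enat_def)
  have \<phi>_in [simp]: "\<phi> Y \<in> Arr \<A> (on_ob R (on_ob T Y)) (on_ob S (on_ob R Y))" if "Y \<in> Obj \<B>" for Y
    using \<phi> that by (simp add: is_enat_def)
  have \<eta>_in [simp]: "\<eta> X \<in> Arr \<A> X (on_ob R (on_ob L X))" if "X \<in> Obj \<A>" for X
    using adj that by (simp add: is_eadj_def is_enat_def)
  have \<epsilon>_in [simp]: "\<epsilon> Y \<in> Arr \<B> (on_ob L (on_ob R Y)) Y" if "Y \<in> Obj \<B>" for Y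
    using adj that by (simp add: is_eadj_def is_enat_def)
  have \<eta>_nat: "Comp \<A> X X' (on_ob R (on_ob L X')) (\<eta> X') f
      = Comp \<A> X (on_ob R (on_ob L X)) (on_ob R (on_ob L X'))
          (on_arr R (on_ob L X) (on_ob L X') (on_arr L X X' f)) (\<eta> X)"
    if "X \<in> Obj \<A>" "X' \<in> Obj \<A>" "f \<in> Arr \<A> X X'" for X X' f
    using adj that by (simp add: is_eadj_def is_enat_def)
  have \<epsilon>_nat: "Comp \<B> (on_ob L (on_ob R Y)) (on_ob L (on_ob R Y')) Y' (\<epsilon> Y')
        (on_arr L (on_ob R Y) (on_ob R Y') (on_arr R Y Y' g))
      = Comp \<B> (on_ob L (on_ob R Y)) Y Y' g (\<epsilon> Y)"
    if "Y \<in> Obj \<B>" "Y' \<in> Obj \<B>" "g \<in> Arr \<B> Y Y'" for Y Y' g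
    using adj that by (simp add: is_eadj_def is_enat_def)
  have \<eta>_coalg: "\<eta> X \<in> Arr ?CA (X, c) (on_ob ?R (on_ob ?L (X, c)))"
    if X: "X \<in> Obj \<A>" and c: "c \<in> Arr \<A> X (on_ob S X)" for X c
  proof -
    let ?LX = "on_ob L X" and ?SX = "on_ob S X"
    let ?RLX = "on_ob R ?LX" and ?LSX = "on_ob L ?SX" and ?TLX = "on_ob T ?LX"
    let ?RLSX = "on_ob R ?LSX" and ?RTLX = "on_ob R ?TLX" and ?SRLX = "on_ob S ?RLX"
    have "Comp \<A> X ?RLX ?SRLX (?d' ?LX (?c' X c)) (\<eta> X)
        = Comp \<A> X ?RTLX ?SRLX (\<phi> ?LX) (Comp \<A> X ?RLSX ?RTLX (on_arr R ?LSX ?TLX (\<delta> X))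
            (Comp \<A> X ?RLX ?RLSX (on_arr R ?LX ?LSX (on_arr L X ?SX c)) (\<eta> X)))"
      using X c by (simp add: L.dom.assoc)
    \<comment> \<open>Naturality of \<open>\<eta>\<close> at the structure map \<open>c\<close>
      moves \<open>c\<close> to the right and exposes the left side of \<open>unit\<close>.\<close>
    also have "\<dots> = Comp \<A> X ?SX ?SRLX (Comp \<A> ?SX ?RTLX ?SRLX (\<phi> ?LX)
        (Comp \<A> ?SX ?RLSX ?RTLX (on_arr R ?LSX ?TLX (\<delta> X)) (\<eta> ?SX))) c"
      using X c by (simp add: L.dom.assoc \<eta>_nat)
    also have "\<dots> = Comp \<A> X ?SX ?SRLX (on_arr S X ?RLX (\<eta> X)) c"
      using X by (simp add: unit)
    finally show ?thesis using X c by simp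
  qed
  have \<epsilon>_coalg: "\<epsilon> Y \<in> Arr ?CB (on_ob ?L (on_ob ?R (Y, d))) (Y, d)"
    if Y: "Y \<in> Obj \<B>" and d: "d \<in> Arr \<B> Y (on_ob T Y)" for Y d
  proof -
    let ?RY = "on_ob R Y" and ?TY = "on_ob T Y"
    let ?LRY = "on_ob L ?RY" and ?RTY = "on_ob R ?TY" and ?SRY = "on_ob S ?RY"
    let ?TLRY = "on_ob T ?LRY" and ?LRTY = "on_ob L ?RTY" and ?LSRY = "on_ob L ?SRY"
    have "Comp \<B> ?LRY ?TLRY ?TY (on_arr T ?LRY Y (\<epsilon> Y)) (?c' ?RY (?d' Y d))
        = Comp \<B> ?LRY ?LRTY ?TY (Comp \<B> ?LRTY ?TLRY ?TY (on_arr T ?LRY Y (\<epsilon> Y))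
            (Comp \<B> ?LRTY ?LSRY ?TLRY (\<delta> ?RY) (on_arr L ?RTY ?SRY (\<phi> Y))))
            (on_arr L ?RY ?RTY (on_arr R Y ?TY d))"
      using Y d by (simp add: L.cod.assoc)
    \<comment> \<open>After \<open>counit\<close>, naturality of \<open>\<epsilon>\<close> at the
      structure map \<open>d\<close> finishes the square.\<close>
    also have "\<dots> = Comp \<B> ?LRY Y ?TY d (\<epsilon> Y)"
      using Y d by (simp add: counit \<epsilon>_nat)
    finally show ?thesis using Y d by simp
  qed
  \<comment> \<open>Coalgebra morphisms compose as their underlying arrows, so naturality and the
    triangle identities are those of the given adjunction.\<close>
  have adj': "is_eadj ?CA ?CB ?L ?R (\<lambda>P. \<eta> (fst P)) (\<lambda>Q. \<epsilon> (fst Q))"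
    unfolding is_eadj_def is_enat_def
  proof (intro conjI ballI L' R')
    fix P assume "P \<in> Obj ?CA"
    then show "\<eta> (fst P) \<in> Arr ?CA (on_ob efun_id P) (on_ob (?R \<circ>\<^sub>F ?L) P)"
      using \<eta>_coalg by (cases P) (simp del: Coalg_Arr)
  next
    fix Q assume "Q \<in> Obj ?CB"
    then show "\<epsilon> (fst Q) \<in> Arr ?CB (on_ob (?L \<circ>\<^sub>F ?R) Q) (on_ob efun_id Q)"
      using \<epsilon>_coalg by (cases Q) (simp del: Coalg_Arr)
  next
    fix P P' f assume "P \<in> Obj ?CA" "P' \<in> Obj ?CA" "f \<in> Arr ?CA P P'"
    then show "Comp ?CA (on_ob efun_id P) (on_ob efun_id P') (on_ob (?R \<circ>\<^sub>F ?L) P') (\<eta> (fst P'))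
          (on_arr efun_id P P' f)
        = Comp ?CA (on_ob efun_id P) (on_ob (?R \<circ>\<^sub>F ?L) P) (on_ob (?R \<circ>\<^sub>F ?L) P')
          (on_arr (?R \<circ>\<^sub>F ?L) P P' f) (\<eta> (fst P))"
      by (cases P; cases P') (simp add: \<eta>_nat)
  next
    fix Q Q' g assume "Q \<in> Obj ?CB" "Q' \<in> Obj ?CB" "g \<in> Arr ?CB Q Q'"
    then show "Comp ?CB (on_ob (?L \<circ>\<^sub>F ?R) Q) (on_ob (?L \<circ>\<^sub>F ?R) Q') (on_ob efun_id Q') (\<epsilon> (fst Q'))
          (on_arr (?L \<circ>\<^sub>F ?R) Q Q' g)
        = Comp ?CB (on_ob (?L \<circ>\<^sub>F ?R) Q) (on_ob efun_id Q) (on_ob efun_id Q')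
          (on_arr efun_id Q Q' g) (\<epsilon> (fst Q))"
      by (cases Q; cases Q') (simp add: \<epsilon>_nat)
  next
    fix P assume "P \<in> Obj ?CA"
    then show "let LA = on_ob ?L P; RLA = on_ob ?R LA; LRLA = on_ob ?L RLA in
        Comp ?CB LA LRLA LA (\<epsilon> (fst LA)) (on_arr ?L P RLA (\<eta> (fst P))) = Id ?CB LA"
      using adj by (cases P) (simp add: is_eadj_def Let_def)
  next
    fix Q assume "Q \<in> Obj ?CB"
    then show "let RB = on_ob ?R Q; LRB = on_ob ?L RB; RLRB = on_ob ?R LRB in
        Comp ?CA RB RLRB RB (on_arr ?R LRB Q (\<epsilon> (fst Q))) (\<eta> (fst RB)) = Id ?CA RB"
      using adj by (cases Q) (simp add: is_eadj_def Let_def)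
  qed
  show ?thesis
    unfolding adjunction_lifts_def
    by (intro exI conjI, rule adj, rule adj') (auto simp: efun_eq_def)
qed

text \<open>The inverse \<open>\<psi>\<close> of \<open>\<phi>\<close> has a mate that lifts
  \<open>L\<close>. The unit condition then reduces to \<open>\<phi>\<psi>\<close> and the counit
  condition to \<open>\<psi>\<phi>\<close>.\<close>

lemma adjunction_lifts_Coalg:
  assumes adj: "is_eadj \<A> \<B> L R \<eta> \<epsilon>" and S: "is_efun \<A> \<A> S" and T: "is_efun \<B> \<B> T"
    and \<phi>: "is_enat \<B> \<A> (R \<circ>\<^sub>F T) (S \<circ>\<^sub>F R) \<phi>"
    and \<psi>_in: "\<And>Y. Y \<in> Obj \<B> \<Longrightarrow> \<psi> Y \<in> Arr \<A> (on_ob S (on_ob R Y)) (on_ob R (on_ob T Y))"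
    and \<psi>\<phi>: "\<And>Y. Y \<in> Obj \<B> \<Longrightarrow>
      Comp \<A> (on_ob R (on_ob T Y)) (on_ob S (on_ob R Y)) (on_ob R (on_ob T Y)) (\<psi> Y) (\<phi> Y)
        = Id \<A> (on_ob R (on_ob T Y))"
    and \<phi>\<psi>: "\<And>Y. Y \<in> Obj \<B> \<Longrightarrow>
      Comp \<A> (on_ob S (on_ob R Y)) (on_ob R (on_ob T Y)) (on_ob S (on_ob R Y)) (\<phi> Y) (\<psi> Y)
        = Id \<A> (on_ob S (on_ob R Y))"
  shows "adjunction_lifts \<A> \<B> L R (Coalg \<A> S) (Coalg \<B> T) forget forget"
proof -
  have L: "is_efun \<A> \<B> L" and R: "is_efun \<B> \<A> R"
    using adj by (simp_all add: is_eadj_def)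
  interpret L: efunctor \<A> \<B> L using L by (simp add: efunctor_def)
  interpret R: efunctor \<B> \<A> R using R by (simp add: efunctor_def)
  interpret S: efunctor \<A> \<A> S using S by (simp add: efunctor_def)
  interpret T: efunctor \<B> \<B> T using T by (simp add: efunctor_def)
  note [simp] = \<psi>_in
  have \<phi>_in [simp]: "\<phi> Y \<in> Arr \<A> (on_ob R (on_ob T Y)) (on_ob S (on_ob R Y))" if "Y \<in> Obj \<B>" for Y
    using \<phi> that by (simp add: is_enat_def)
  have \<phi>_nat: "Comp \<A> (on_ob R (on_ob T Y)) (on_ob R (on_ob T Y')) (on_ob S (on_ob R Y')) (\<phi> Y')
        (on_arr R (on_ob T Y) (on_ob T Y') (on_arr T Y Y' g))
      = Comp \<A> (on_ob R (on_ob T Y)) (on_ob S (on_ob R Y)) (on_ob S (on_ob R Y'))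
        (on_arr S (on_ob R Y) (on_ob R Y') (on_arr R Y Y' g)) (\<phi> Y)"
    if "Y \<in> Obj \<B>" "Y' \<in> Obj \<B>" "g \<in> Arr \<B> Y Y'" for Y Y' g
    using \<phi> that by (simp add: is_enat_def)
  \<comment> \<open>A pointwise inverse of a natural family is natural: the identity
    \<open>\<phi> Y\<close> after \<open>\<psi> Y\<close> is inserted, naturality of
    \<open>\<phi>\<close> is used, and \<open>\<psi> Y'\<close> after \<open>\<phi> Y'\<close>
    cancels.\<close>
  have \<psi>_nat: "Comp \<A> (on_ob S (on_ob R Y)) (on_ob S (on_ob R Y')) (on_ob R (on_ob T Y')) (\<psi> Y')
        (on_arr S (on_ob R Y) (on_ob R Y') (on_arr R Y Y' g))
      = Comp \<A> (on_ob S (on_ob R Y)) (on_ob R (on_ob T Y)) (on_ob R (on_ob T Y'))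
        (on_arr R (on_ob T Y) (on_ob T Y') (on_arr T Y Y' g)) (\<psi> Y)"
    if Y: "Y \<in> Obj \<B>" "Y' \<in> Obj \<B>" and g: "g \<in> Arr \<B> Y Y'" for Y Y' g
  proof -
    let ?SRY = "on_ob S (on_ob R Y)" and ?SRY' = "on_ob S (on_ob R Y')"
      and ?RTY = "on_ob R (on_ob T Y)" and ?RTY' = "on_ob R (on_ob T Y')"
    let ?Sg = "on_arr S (on_ob R Y) (on_ob R Y') (on_arr R Y Y' g)"
    let ?Tg = "on_arr R (on_ob T Y) (on_ob T Y') (on_arr T Y Y' g)"
    have "Comp \<A> ?SRY ?SRY' ?RTY' (\<psi> Y') ?Sg
        = Comp \<A> ?SRY ?SRY' ?RTY' (\<psi> Y') (Comp \<A> ?SRY ?SRY ?SRY' ?Sg (Comp \<A> ?SRY ?RTY ?SRY (\<phi> Y) (\<psi> Y)))"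
      using Y g by (simp add: \<phi>\<psi>)
    also have "\<dots> = Comp \<A> ?SRY ?SRY' ?RTY' (\<psi> Y')
        (Comp \<A> ?SRY ?RTY ?SRY' (Comp \<A> ?RTY ?SRY ?SRY' ?Sg (\<phi> Y)) (\<psi> Y))"
      using Y g by (simp add: L.dom.assoc)
    also have "\<dots> = Comp \<A> ?SRY ?SRY' ?RTY' (\<psi> Y')
        (Comp \<A> ?SRY ?RTY ?SRY' (Comp \<A> ?RTY ?RTY' ?SRY' (\<phi> Y') ?Tg) (\<psi> Y))"
      using Y g by (simp add: \<phi>_nat)
    also have "\<dots> = Comp \<A> ?SRY ?RTY' ?RTY' (Comp \<A> ?RTY' ?SRY' ?RTY' (\<psi> Y') (\<phi> Y'))
        (Comp \<A> ?SRY ?RTY ?RTY' ?Tg (\<psi> Y))"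
      using Y g by (simp add: L.dom.assoc)
    also have "\<dots> = Comp \<A> ?SRY ?RTY ?RTY' ?Tg (\<psi> Y)"
      using Y g by (simp add: \<psi>\<phi>)
    finally show ?thesis .
  qed
  have \<eta>_in [simp]: "\<eta> X \<in> Arr \<A> X (on_ob R (on_ob L X))" if "X \<in> Obj \<A>" for X
    using adj that by (simp add: is_eadj_def is_enat_def)
  have \<epsilon>_in [simp]: "\<epsilon> Y \<in> Arr \<B> (on_ob L (on_ob R Y)) Y" if "Y \<in> Obj \<B>" for Y
    using adj that by (simp add: is_eadj_def is_enat_def)
  have \<eta>_nat: "Comp \<A> X X' (on_ob R (on_ob L X')) (\<eta> X') f
      = Comp \<A> X (on_ob R (on_ob L X)) (on_ob R (on_ob L X'))
          (on_arr R (on_ob L X) (on_ob L X') (on_arr L X X' f)) (\<eta> X)"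
    if "X \<in> Obj \<A>" "X' \<in> Obj \<A>" "f \<in> Arr \<A> X X'" for X X' f
    using adj that by (simp add: is_eadj_def is_enat_def)
  have \<epsilon>_nat: "Comp \<B> (on_ob L (on_ob R Y)) (on_ob L (on_ob R Y')) Y' (\<epsilon> Y')
        (on_arr L (on_ob R Y) (on_ob R Y') (on_arr R Y Y' g))
      = Comp \<B> (on_ob L (on_ob R Y)) Y Y' g (\<epsilon> Y)"
    if "Y \<in> Obj \<B>" "Y' \<in> Obj \<B>" "g \<in> Arr \<B> Y Y'" for Y Y' g
    using adj that by (simp add: is_eadj_def is_enat_def)
  have triangle: "Comp \<A> (on_ob R Y) (on_ob R (on_ob L (on_ob R Y))) (on_ob R Y)
      (on_arr R (on_ob L (on_ob R Y)) Y (\<epsilon> Y)) (\<eta> (on_ob R Y)) = Id \<A> (on_ob R Y)"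
    if "Y \<in> Obj \<B>" for Y
    using adj that by (simp add: is_eadj_def Let_def)
  \<comment> \<open>\<open>\<delta>\<close> is the mate of \<open>\<psi>\<close>, and \<open>k\<close> its transpose.\<close>
  define k where "k X = Comp \<A> (on_ob S X) (on_ob S (on_ob R (on_ob L X))) (on_ob R (on_ob T (on_ob L X)))
      (\<psi> (on_ob L X)) (on_arr S X (on_ob R (on_ob L X)) (\<eta> X))" for X
  define \<delta> where "\<delta> X = Comp \<B> (on_ob L (on_ob S X)) (on_ob L (on_ob R (on_ob T (on_ob L X)))) (on_ob T (on_ob L X))
      (\<epsilon> (on_ob T (on_ob L X))) (on_arr L (on_ob S X) (on_ob R (on_ob T (on_ob L X))) (k X))" for X
  have k_in [simp]: "k X \<in> Arr \<A> (on_ob S X) (on_ob R (on_ob T (on_ob L X)))" if "X \<in> Obj \<A>" for X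
    using that by (simp add: k_def)
  have \<delta>_in [simp]: "\<delta> X \<in> Arr \<B> (on_ob L (on_ob S X)) (on_ob T (on_ob L X))" if "X \<in> Obj \<A>" for X
    using that by (simp add: \<delta>_def)
  have k_nat: "Comp \<A> (on_ob S X) (on_ob S X') (on_ob R (on_ob T (on_ob L X'))) (k X') (on_arr S X X' f)
      = Comp \<A> (on_ob S X) (on_ob R (on_ob T (on_ob L X))) (on_ob R (on_ob T (on_ob L X')))
          (on_arr R (on_ob T (on_ob L X)) (on_ob T (on_ob L X')) (on_arr T (on_ob L X) (on_ob L X') (on_arr L X X' f)))
          (k X)"
    if X: "X \<in> Obj \<A>" "X' \<in> Obj \<A>" and f: "f \<in> Arr \<A> X X'" for X X' f
  proof -
    let ?SX = "on_ob S X" and ?SX' = "on_ob S X'" and ?RLX = "on_ob R (on_ob L X)" and ?RLX' = "on_ob R (on_ob L X')"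
    let ?SRLX = "on_ob S ?RLX" and ?SRLX' = "on_ob S ?RLX'"
      and ?RTLX = "on_ob R (on_ob T (on_ob L X))" and ?RTLX' = "on_ob R (on_ob T (on_ob L X'))"
    let ?RLf = "on_arr R (on_ob L X) (on_ob L X') (on_arr L X X' f)"
    have "Comp \<A> ?SX ?SX' ?RTLX' (k X') (on_arr S X X' f)
        = Comp \<A> ?SX ?SRLX' ?RTLX' (\<psi> (on_ob L X')) (on_arr S X ?RLX' (Comp \<A> X X' ?RLX' (\<eta> X') f))"
      using X f by (simp add: k_def L.dom.assoc)
    also have "\<dots> = Comp \<A> ?SX ?SRLX' ?RTLX' (\<psi> (on_ob L X'))
        (on_arr S X ?RLX' (Comp \<A> X ?RLX ?RLX' ?RLf (\<eta> X)))"
      using X f by (simp only: \<eta>_nat)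
    also have "\<dots> = Comp \<A> ?SX ?SRLX ?RTLX'
        (Comp \<A> ?SRLX ?SRLX' ?RTLX' (\<psi> (on_ob L X')) (on_arr S ?RLX ?RLX' ?RLf)) (on_arr S X ?RLX (\<eta> X))"
      using X f by (simp add: L.dom.assoc)
    also have "\<dots> = Comp \<A> ?SX ?RTLX ?RTLX'
        (on_arr R (on_ob T (on_ob L X)) (on_ob T (on_ob L X')) (on_arr T (on_ob L X) (on_ob L X') (on_arr L X X' f)))
        (k X)"
      using X f by (simp add: k_def L.dom.assoc \<psi>_nat)
    finally show ?thesis .
  qed
  have \<delta>_nat: "is_enat \<A> \<B> (L \<circ>\<^sub>F S) (T \<circ>\<^sub>F L) \<delta>"
    unfolding is_enat_def efun_comp_simps
  proof (intro conjI ballI)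
    fix X X' f assume X: "X \<in> Obj \<A>" "X' \<in> Obj \<A>" and f: "f \<in> Arr \<A> X X'"
    let ?SX = "on_ob S X" and ?SX' = "on_ob S X'" and ?LX = "on_ob L X" and ?LX' = "on_ob L X'"
    let ?LSX = "on_ob L ?SX" and ?LSX' = "on_ob L ?SX'" and ?TLX = "on_ob T ?LX" and ?TLX' = "on_ob T ?LX'"
    let ?RTLX = "on_ob R ?TLX" and ?RTLX' = "on_ob R ?TLX'"
    let ?LRTLX = "on_ob L ?RTLX" and ?LRTLX' = "on_ob L ?RTLX'"
    let ?TLf = "on_arr T ?LX ?LX' (on_arr L X X' f)"
    have "Comp \<B> ?LSX ?LSX' ?TLX' (\<delta> X') (on_arr L ?SX ?SX' (on_arr S X X' f))
        = Comp \<B> ?LSX ?LRTLX' ?TLX' (\<epsilon> ?TLX')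
            (on_arr L ?SX ?RTLX' (Comp \<A> ?SX ?SX' ?RTLX' (k X') (on_arr S X X' f)))"
      using X f by (simp add: \<delta>_def L.cod.assoc)
    also have "\<dots> = Comp \<B> ?LSX ?LRTLX' ?TLX' (\<epsilon> ?TLX')
            (on_arr L ?SX ?RTLX' (Comp \<A> ?SX ?RTLX ?RTLX' (on_arr R ?TLX ?TLX' ?TLf) (k X)))"
      using X f by (simp only: k_nat)
    also have "\<dots> = Comp \<B> ?LSX ?LRTLX ?TLX' (Comp \<B> ?LRTLX ?LRTLX' ?TLX' (\<epsilon> ?TLX')
            (on_arr L ?RTLX ?RTLX' (on_arr R ?TLX ?TLX' ?TLf))) (on_arr L ?SX ?RTLX (k X))"
      using X f by (simp add: L.cod.assoc)
    also have "\<dots> = Comp \<B> ?LSX ?TLX ?TLX' ?TLf (\<delta> X)"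
      using X f by (simp add: \<epsilon>_nat \<delta>_def L.cod.assoc)
    finally show "Comp \<B> ?LSX ?LSX' ?TLX' (\<delta> X') (on_arr L ?SX ?SX' (on_arr S X X' f))
      = Comp \<B> ?LSX ?TLX ?TLX' ?TLf (\<delta> X)" .
  qed simp
  show ?thesis
  proof (rule is_eadj_Coalg_lift[OF adj S T \<delta>_nat \<phi>])
    fix X assume X: "X \<in> Obj \<A>"
    let ?SX = "on_ob S X" and ?LX = "on_ob L X"
    let ?LSX = "on_ob L ?SX" and ?TLX = "on_ob T ?LX" and ?RLX = "on_ob R ?LX"
    let ?RTLX = "on_ob R ?TLX" and ?RLSX = "on_ob R ?LSX" and ?SRLX = "on_ob S ?RLX"
    let ?LRTLX = "on_ob L ?RTLX"
    \<comment> \<open>Transposing \<open>\<delta> X\<close> back gives \<open>k X\<close>: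
      naturality of \<open>\<eta>\<close> at \<open>k X\<close>, then the triangle identity at
      \<open>T L X\<close>.\<close>
    have "Comp \<A> ?SX ?RLSX ?RTLX (on_arr R ?LSX ?TLX (\<delta> X)) (\<eta> ?SX)
        = Comp \<A> ?SX (on_ob R ?LRTLX) ?RTLX (on_arr R ?LRTLX ?TLX (\<epsilon> ?TLX))
            (Comp \<A> ?SX ?RTLX (on_ob R ?LRTLX) (\<eta> ?RTLX) (k X))"
      using X by (simp add: \<delta>_def L.dom.assoc \<eta>_nat)
    also have "\<dots> = Comp \<A> ?SX ?RTLX ?RTLX (Comp \<A> ?RTLX (on_ob R ?LRTLX) ?RTLX
        (on_arr R ?LRTLX ?TLX (\<epsilon> ?TLX)) (\<eta> ?RTLX)) (k X)"
      using X by (simp add: L.dom.assoc)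
    also have "\<dots> = k X" using X by (simp add: triangle)
    finally have *: "Comp \<A> ?SX ?RLSX ?RTLX (on_arr R ?LSX ?TLX (\<delta> X)) (\<eta> ?SX) = k X" .
    have "Comp \<A> ?SX ?RTLX ?SRLX (\<phi> ?LX) (k X)
        = Comp \<A> ?SX ?SRLX ?SRLX (Comp \<A> ?SRLX ?RTLX ?SRLX (\<phi> ?LX) (\<psi> ?LX)) (on_arr S X ?RLX (\<eta> X))"
      using X by (simp add: k_def L.dom.assoc)
    then show "Comp \<A> ?SX ?RTLX ?SRLX (\<phi> ?LX)
        (Comp \<A> ?SX ?RLSX ?RTLX (on_arr R ?LSX ?TLX (\<delta> X)) (\<eta> ?SX)) = on_arr S X ?RLX (\<eta> X)"
      using X by (simp add: * \<phi>\<psi>)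
  next
    fix Y assume Y: "Y \<in> Obj \<B>"
    let ?RY = "on_ob R Y" and ?TY = "on_ob T Y"
    let ?LRY = "on_ob L ?RY" and ?RTY = "on_ob R ?TY" and ?SRY = "on_ob S ?RY"
    let ?TLRY = "on_ob T ?LRY" and ?LRTY = "on_ob L ?RTY" and ?LSRY = "on_ob L ?SRY" and ?RLRY = "on_ob R ?LRY"
    let ?RTLRY = "on_ob R ?TLRY" and ?SRLRY = "on_ob S ?RLRY"
    let ?LRTLRY = "on_ob L ?RTLRY"
    let ?T\<epsilon> = "on_arr T ?LRY Y (\<epsilon> Y)"
    \<comment> \<open>Naturality of \<open>\<psi>\<close> at the counit reduces this to
      \<open>S\<close> applied to a triangle identity.\<close>
    have "Comp \<A> ?SRY ?RTLRY ?RTY (on_arr R ?TLRY ?TY ?T\<epsilon>) (k ?RY)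
        = Comp \<A> ?SRY ?SRLRY ?RTY (Comp \<A> ?SRLRY ?RTLRY ?RTY (on_arr R ?TLRY ?TY ?T\<epsilon>) (\<psi> ?LRY))
            (on_arr S ?RY ?RLRY (\<eta> ?RY))"
      using Y by (simp add: k_def L.dom.assoc)
    also have "\<dots> = Comp \<A> ?SRY ?SRY ?RTY (\<psi> Y)
        (on_arr S ?RY ?RY (Comp \<A> ?RY ?RLRY ?RY (on_arr R ?LRY Y (\<epsilon> Y)) (\<eta> ?RY)))"
      using Y by (simp add: \<psi>_nat[symmetric] L.dom.assoc)
    \<comment> \<open>\<open>S\<close> must stay outside the composite, so that
      \<open>triangle\<close> can replace the composite by an identity.\<close>
    also have "\<dots> = \<psi> Y"
      using Y by (simp add: triangle del: S.arr_comp)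
    finally have *: "Comp \<A> ?SRY ?RTLRY ?RTY (on_arr R ?TLRY ?TY ?T\<epsilon>) (k ?RY) = \<psi> Y" .
    \<comment> \<open>Naturality of \<open>\<epsilon>\<close> at \<open>?T\<epsilon>\<close> brings
      in the composite just identified with \<open>\<psi> Y\<close>.\<close>
    have "Comp \<B> ?LSRY ?TLRY ?TY ?T\<epsilon> (\<delta> ?RY)
        = Comp \<B> ?LSRY ?LRTLRY ?TY (Comp \<B> ?LRTLRY ?TLRY ?TY ?T\<epsilon> (\<epsilon> ?TLRY)) (on_arr L ?SRY ?RTLRY (k ?RY))"
      using Y by (simp add: \<delta>_def L.cod.assoc)
    also have "\<dots> = Comp \<B> ?LSRY ?LRTY ?TY (\<epsilon> ?TY)
        (on_arr L ?SRY ?RTY (Comp \<A> ?SRY ?RTLRY ?RTY (on_arr R ?TLRY ?TY ?T\<epsilon>) (k ?RY)))"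
      using Y by (simp add: \<epsilon>_nat[symmetric] L.cod.assoc)
    finally have **: "Comp \<B> ?LSRY ?TLRY ?TY ?T\<epsilon> (\<delta> ?RY)
        = Comp \<B> ?LSRY ?LRTY ?TY (\<epsilon> ?TY) (on_arr L ?SRY ?RTY (\<psi> Y))"
      by (simp add: *)
    have "Comp \<B> ?LRTY ?TLRY ?TY ?T\<epsilon> (Comp \<B> ?LRTY ?LSRY ?TLRY (\<delta> ?RY) (on_arr L ?RTY ?SRY (\<phi> Y)))
        = Comp \<B> ?LRTY ?LSRY ?TY (Comp \<B> ?LSRY ?TLRY ?TY ?T\<epsilon> (\<delta> ?RY)) (on_arr L ?RTY ?SRY (\<phi> Y))"
      using Y by (simp add: L.cod.assoc)
    also have "\<dots> = Comp \<B> ?LRTY ?LRTY ?TY (\<epsilon> ?TY) (on_arr L ?RTY ?RTY (Comp \<A> ?RTY ?SRY ?RTY (\<psi> Y) (\<phi> Y)))"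
      using Y by (simp add: ** L.cod.assoc)
    also have "\<dots> = \<epsilon> ?TY"
      using Y by (simp add: \<psi>\<phi> del: L.arr_comp)
    finally show "Comp \<B> ?LRTY ?TLRY ?TY ?T\<epsilon>
      (Comp \<B> ?LRTY ?LSRY ?TLRY (\<delta> ?RY) (on_arr L ?RTY ?SRY (\<phi> Y))) = \<epsilon> ?TY" .
  qed
qed

section \<open>Left Kan extensions\<close>

text \<open>Only the object part of the universal property of the weighted colimit: this is all that is
  needed to compare two left Kan extensions.\<close>

definition universal_cocone ::
    "('o, 'm, 'v::comm_quantale) ecat \<Rightarrow> ('p, 'n, 'v) ecat \<Rightarrow> ('q, 'k, 'v) ecat \<Rightarrow>
       ('o, 'm, 'p, 'n) efun \<Rightarrow> ('o, 'm, 'q, 'k) efun \<Rightarrow> 'p \<Rightarrow> 'q \<Rightarrow> ('o \<Rightarrow> 'n \<Rightarrow> 'k) \<Rightarrow> bool" where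
  "universal_cocone \<A> \<C> \<B> J H X K \<kappa> \<longleftrightarrow>
     K \<in> Obj \<B> \<and> is_cocone \<A> \<C> \<B> J H X K \<kappa> \<and>
     (\<forall>Z\<in>Obj \<B>. \<forall>\<alpha>. is_cocone \<A> \<C> \<B> J H X Z \<alpha> \<longrightarrow>
       (\<exists>!k. k \<in> Arr \<B> K Z \<and>
         (\<forall>S\<in>Obj \<A>. \<forall>f\<in>Arr \<C> (on_ob J S) X. Comp \<B> (on_ob H S) K Z k (\<kappa> S f) = \<alpha> S f)))"

text \<open>The image of the identity on \<open>L X\<close> under the comparison map of
  \<open>is_lan\<close>; the restrictions meet the extensionality demanded of cocones.\<close>

definition lan_cocone ::
    "('o, 'm, 'v::comm_quantale) ecat \<Rightarrow> ('p, 'n, 'v) ecat \<Rightarrow> ('q, 'k, 'v) ecat \<Rightarrow>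
       ('o, 'm, 'p, 'n) efun \<Rightarrow> ('o, 'm, 'q, 'k) efun \<Rightarrow> ('p, 'n, 'q, 'k) efun \<Rightarrow> ('o \<Rightarrow> 'k) \<Rightarrow>
       'p \<Rightarrow> 'o \<Rightarrow> 'n \<Rightarrow> 'k" where
  "lan_cocone \<A> \<C> \<B> J H L \<eta> X = (\<lambda>S\<in>Obj \<A>. \<lambda>f\<in>Arr \<C> (on_ob J S) X.
     Comp \<B> (on_ob H S) (on_ob L (on_ob J S)) (on_ob L X) (on_arr L (on_ob J S) X f) (\<eta> S))"

section \<open>Cocones and mediating arrows\<close>

lemma universal_coconeD:
  assumes "universal_cocone \<A> \<C> \<B> J H X K \<kappa>"
  shows "K \<in> Obj \<B>" "is_cocone \<A> \<C> \<B> J H X K \<kappa>"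
    "\<lbrakk>Z \<in> Obj \<B>; is_cocone \<A> \<C> \<B> J H X Z \<alpha>\<rbrakk> \<Longrightarrow> \<exists>k \<in> Arr \<B> K Z.
       \<forall>S\<in>Obj \<A>. \<forall>f\<in>Arr \<C> (on_ob J S) X. Comp \<B> (on_ob H S) K Z k (\<kappa> S f) = \<alpha> S f"
  using assms unfolding universal_cocone_def by blast+

lemma is_cocone_in:
  assumes "is_cocone \<A> \<C> \<B> J H X Z \<alpha>" "S \<in> Obj \<A>" "f \<in> Arr \<C> (on_ob J S) X"
  shows "\<alpha> S f \<in> Arr \<B> (on_ob H S) Z"
  using assms unfolding is_cocone_def is_vfun_def by blast

text \<open>Composition is monotone in both variables; holding \<open>k\<close> fixed costs nothing
  because \<open>1\<close> lies below the hom from \<open>k\<close> to itself.\<close>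

lemma is_cocone_comp:
  assumes J: "is_efun \<A> \<C> J" and H: "is_efun \<A> \<B> H"
    and \<alpha>: "is_cocone \<A> \<C> \<B> J H X Z \<alpha>" and X: "X \<in> Obj \<C>" and Z: "Z \<in> Obj \<B>" "Z' \<in> Obj \<B>"
    and k: "k \<in> Arr \<B> Z Z'"
  shows "is_cocone \<A> \<C> \<B> J H X Z'
    (\<lambda>S\<in>Obj \<A>. \<lambda>f\<in>Arr \<C> (on_ob J S) X. Comp \<B> (on_ob H S) Z Z' k (\<alpha> S f))"
proof -
  interpret J: efunctor \<A> \<C> J using J by (simp add: efunctor_def)
  interpret H: efunctor \<A> \<B> H using H by (simp add: efunctor_def)
  have in\<alpha>: "\<alpha> S f \<in> Arr \<B> (on_ob H S) Z" if "S \<in> Obj \<A>" "f \<in> Arr \<C> (on_ob J S) X" for S f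
    using is_cocone_in[OF \<alpha>] that by blast
  show ?thesis
    unfolding is_cocone_def
  proof (intro conjI ballI)
    fix S assume S: "S \<in> Obj \<A>"
    show "is_vfun (Hom \<C> (on_ob J S) X) (Hom \<B> (on_ob H S) Z')
      ((\<lambda>S\<in>Obj \<A>. \<lambda>f\<in>Arr \<C> (on_ob J S) X. Comp \<B> (on_ob H S) Z Z' k (\<alpha> S f)) S)"
      unfolding is_vfun_def
    proof (intro conjI ballI)
      show "(\<lambda>S\<in>Obj \<A>. \<lambda>f\<in>Arr \<C> (on_ob J S) X. Comp \<B> (on_ob H S) Z Z' k (\<alpha> S f)) S
        \<in> Arr \<C> (on_ob J S) X \<rightarrow>\<^sub>E Arr \<B> (on_ob H S) Z'"
        using S Z k in\<alpha> by auto
    next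
      fix f g assume f: "f \<in> Arr \<C> (on_ob J S) X" and g: "g \<in> Arr \<C> (on_ob J S) X"
      have "vhom (Hom \<C> (on_ob J S) X) f g \<le> vhom (Hom \<B> (on_ob H S) Z) (\<alpha> S f) (\<alpha> S g)"
        using \<alpha> S f g unfolding is_cocone_def is_vfun_def by blast
      also have "\<dots> = 1 * vhom (Hom \<B> (on_ob H S) Z) (\<alpha> S f) (\<alpha> S g)" by simp
      also have "\<dots> \<le> vhom (Hom \<B> Z Z') k k * vhom (Hom \<B> (on_ob H S) Z) (\<alpha> S f) (\<alpha> S g)"
      proof -
        have "1 \<le> vhom (Hom \<B> Z Z') k k"
          using H.cod.hom_vcat[OF Z] k by (simp add: is_vcat_def)
        then show ?thesis
          by (rule times_left_mono)
      qed
      also have "\<dots> \<le> vhom (Hom \<B> (on_ob H S) Z') (Comp \<B> (on_ob H S) Z Z' k (\<alpha> S f))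
          (Comp \<B> (on_ob H S) Z Z' k (\<alpha> S g))"
        using S Z k in\<alpha> f g by (simp add: H.cod.comp_mono)
      finally show "vhom (Hom \<C> (on_ob J S) X) f g \<le> vhom (Hom \<B> (on_ob H S) Z')
          ((\<lambda>S\<in>Obj \<A>. \<lambda>f\<in>Arr \<C> (on_ob J S) X. Comp \<B> (on_ob H S) Z Z' k (\<alpha> S f)) S f)
          ((\<lambda>S\<in>Obj \<A>. \<lambda>f\<in>Arr \<C> (on_ob J S) X. Comp \<B> (on_ob H S) Z Z' k (\<alpha> S f)) S g)"
        using S f g by simp
    qed
  next
    fix S S' u f
    assume A: "S \<in> Obj \<A>" "S' \<in> Obj \<A>" "u \<in> Arr \<A> S' S" "f \<in> Arr \<C> (on_ob J S) X"
    have "\<alpha> S' (Comp \<C> (on_ob J S') (on_ob J S) X f (on_arr J S' S u))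
      = Comp \<B> (on_ob H S') (on_ob H S) Z (\<alpha> S f) (on_arr H S' S u)"
      using \<alpha> A unfolding is_cocone_def by blast
    then show "(\<lambda>S\<in>Obj \<A>. \<lambda>f\<in>Arr \<C> (on_ob J S) X. Comp \<B> (on_ob H S) Z Z' k (\<alpha> S f)) S'
        (Comp \<C> (on_ob J S') (on_ob J S) X f (on_arr J S' S u))
      = Comp \<B> (on_ob H S') (on_ob H S) Z'
        ((\<lambda>S\<in>Obj \<A>. \<lambda>f\<in>Arr \<C> (on_ob J S) X. Comp \<B> (on_ob H S) Z Z' k (\<alpha> S f)) S f)
        (on_arr H S' S u)"
      using A X Z k in\<alpha> by (simp add: H.cod.assoc)
  qed simp
qed

text \<open>Both arrows mediate the cocone obtained by composing \<open>k\<close> with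
  \<open>\<kappa>\<close>. Equations between arrows out of a colimit are thus checked on
  legs.\<close>

lemma universal_cocone_unique:
  assumes J: "is_efun \<A> \<C> J" and H: "is_efun \<A> \<B> H"
    and \<kappa>: "universal_cocone \<A> \<C> \<B> J H X K \<kappa>" and X: "X \<in> Obj \<C>" and Z: "Z \<in> Obj \<B>"
    and k: "k \<in> Arr \<B> K Z" and l: "l \<in> Arr \<B> K Z"
    and eq: "\<And>S f. \<lbrakk>S \<in> Obj \<A>; f \<in> Arr \<C> (on_ob J S) X\<rbrakk> \<Longrightarrow>
      Comp \<B> (on_ob H S) K Z k (\<kappa> S f) = Comp \<B> (on_ob H S) K Z l (\<kappa> S f)"
  shows "k = l"
proof -
  let ?\<alpha> = "\<lambda>S\<in>Obj \<A>. \<lambda>f\<in>Arr \<C> (on_ob J S) X. Comp \<B> (on_ob H S) K Z k (\<kappa> S f)"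
  have "is_cocone \<A> \<C> \<B> J H X Z ?\<alpha>"
    using is_cocone_comp[OF J H universal_coconeD(2)[OF \<kappa>] X
      universal_coconeD(1)[OF \<kappa>] Z k] .
  then have "\<exists>!k. k \<in> Arr \<B> K Z \<and>
      (\<forall>S\<in>Obj \<A>. \<forall>f\<in>Arr \<C> (on_ob J S) X. Comp \<B> (on_ob H S) K Z k (\<kappa> S f) = ?\<alpha> S f)"
    using \<kappa> Z unfolding universal_cocone_def by blast
  moreover have "\<forall>S\<in>Obj \<A>. \<forall>f\<in>Arr \<C> (on_ob J S) X. Comp \<B> (on_ob H S) K Z k (\<kappa> S f) = ?\<alpha> S f"
    "\<forall>S\<in>Obj \<A>. \<forall>f\<in>Arr \<C> (on_ob J S) X. Comp \<B> (on_ob H S) K Z l (\<kappa> S f) = ?\<alpha> S f"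
    using eq by simp_all
  ultimately show ?thesis using k l by blast
qed

text \<open>A Yoneda argument: the comparison bijection has the form \<open>k\<close> composed with
  the cocone at the identity, so its bijectivity is unique existence of mediating arrows.\<close>

lemma universal_lan_cocone:
  assumes lan: "is_lan \<A> \<C> \<B> J H L \<eta>" and X: "X \<in> Obj \<C>"
  shows "universal_cocone \<A> \<C> \<B> J H X (on_ob L X) (lan_cocone \<A> \<C> \<B> J H L \<eta> X)"
proof -
  interpret J: efunctor \<A> \<C> J using lan by (simp add: efunctor_def is_lan_def)
  interpret H: efunctor \<A> \<B> H using lan by (simp add: efunctor_def is_lan_def)
  interpret L: efunctor \<C> \<B> L using lan by (simp add: efunctor_def is_lan_def)
  have [simp]: "\<eta> S \<in> Arr \<B> (on_ob H S) (on_ob L (on_ob J S))" if "S \<in> Obj \<A>" for S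
    using lan that by (simp add: is_lan_def is_enat_def)
  let ?\<kappa> = "lan_cocone \<A> \<C> \<B> J H L \<eta> X"
  let ?\<Phi> = "\<lambda>Z k. \<lambda>S\<in>Obj \<A>. \<lambda>f\<in>Arr \<C> (on_ob J S) X. Comp \<B> (on_ob H S) (on_ob L X) Z k (?\<kappa> S f)"
  have bij: "bij_betw (?\<Phi> Z) (Arr \<B> (on_ob L X) Z) {\<alpha>. is_cocone \<A> \<C> \<B> J H X Z \<alpha>}"
    if "Z \<in> Obj \<B>" for Z
  proof -
    have "?\<Phi> Z = (\<lambda>k. \<lambda>S\<in>Obj \<A>. \<lambda>f\<in>Arr \<C> (on_ob J S) X.
             Comp \<B> (on_ob H S) (on_ob L X) Z k
               (Comp \<B> (on_ob H S) (on_ob L (on_ob J S)) (on_ob L X)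
                  (on_arr L (on_ob J S) X f) (\<eta> S)))"
      by (simp add: lan_cocone_def fun_eq_iff restrict_def)
    then show ?thesis
      using lan X that by (simp add: is_lan_def is_viso_def cocone_cat_def)
  qed
  \<comment> \<open>The bijection takes values in cocones, so it suffices to evaluate it at the
    identity.\<close>
  have id: "?\<Phi> (on_ob L X) (Id \<B> (on_ob L X)) = ?\<kappa>"
    using X by (simp add: fun_eq_iff lan_cocone_def restrict_def)
  have "?\<Phi> (on_ob L X) (Id \<B> (on_ob L X)) \<in> {\<alpha>. is_cocone \<A> \<C> \<B> J H X (on_ob L X) \<alpha>}"
    by (rule bij_betw_apply[OF bij[OF L.ob_in[OF X]] H.cod.id_in[OF L.ob_in[OF X]]])
  then have "is_cocone \<A> \<C> \<B> J H X (on_ob L X) ?\<kappa>"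
    unfolding id by (rule CollectD)
  moreover have "\<exists>!k. k \<in> Arr \<B> (on_ob L X) Z \<and>
      (\<forall>S\<in>Obj \<A>. \<forall>f\<in>Arr \<C> (on_ob J S) X. Comp \<B> (on_ob H S) (on_ob L X) Z k (?\<kappa> S f) = \<alpha> S f)"
    if Z: "Z \<in> Obj \<B>" and \<alpha>: "is_cocone \<A> \<C> \<B> J H X Z \<alpha>" for Z \<alpha>
  proof -
    have ext: "\<alpha> \<in> extensional (Obj \<A>)" "\<And>S. S \<in> Obj \<A> \<Longrightarrow> \<alpha> S \<in> extensional (Arr \<C> (on_ob J S) X)"
      using \<alpha> by (auto simp: is_cocone_def is_vfun_def PiE_iff)
    \<comment> \<open>Agreement on all legs is equality of functions, because cocones are
      extensional in both arguments.\<close>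
    have eq: "?\<Phi> Z k = \<alpha> \<longleftrightarrow>
      (\<forall>S\<in>Obj \<A>. \<forall>f\<in>Arr \<C> (on_ob J S) X. Comp \<B> (on_ob H S) (on_ob L X) Z k (?\<kappa> S f) = \<alpha> S f)" for k
    proof
      assume "?\<Phi> Z k = \<alpha>"
      then show "\<forall>S\<in>Obj \<A>. \<forall>f\<in>Arr \<C> (on_ob J S) X.
          Comp \<B> (on_ob H S) (on_ob L X) Z k (?\<kappa> S f) = \<alpha> S f"
        by auto
    next
      assume R: "\<forall>S\<in>Obj \<A>. \<forall>f\<in>Arr \<C> (on_ob J S) X.
          Comp \<B> (on_ob H S) (on_ob L X) Z k (?\<kappa> S f) = \<alpha> S f"
      show "?\<Phi> Z k = \<alpha>"
      proof (rule extensionalityI[OF _ ext(1)])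
        fix S assume S: "S \<in> Obj \<A>"
        show "?\<Phi> Z k S = \<alpha> S"
          using S R by (intro extensionalityI[OF _ ext(2)]) auto
      qed simp
    qed
    have "\<exists>!k. k \<in> Arr \<B> (on_ob L X) Z \<and> ?\<Phi> Z k = \<alpha>"
    proof -
      have "\<alpha> \<in> ?\<Phi> Z ` Arr \<B> (on_ob L X) Z"
        unfolding bij_betw_imp_surj_on[OF bij[OF Z]] using \<alpha> by simp
      then obtain k where k: "\<alpha> = ?\<Phi> Z k" "k \<in> Arr \<B> (on_ob L X) Z" by (rule imageE)
      show ?thesis
      proof (intro ex1I conjI)
        show "k \<in> Arr \<B> (on_ob L X) Z" "?\<Phi> Z k = \<alpha>" using k by simp_all
        fix l assume "l \<in> Arr \<B> (on_ob L X) Z \<and> ?\<Phi> Z l = \<alpha>"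
        then show "l = k"
          using inj_onD[OF bij_betw_imp_inj_on[OF bij[OF Z]], of l k] k by simp
      qed
    qed
    then show ?thesis by (simp only: eq)
  qed
  ultimately show ?thesis using X by (simp add: universal_cocone_def)
qed

text \<open>Functoriality of \<open>L\<close> and associativity. Comparison arrows between Kan
  extensions are natural for this reason.\<close>

lemma lan_cocone_nat:
  assumes lan: "is_lan \<A> \<C> \<B> J H L \<eta>" and X: "X \<in> Obj \<C>" "Y \<in> Obj \<C>" and g: "g \<in> Arr \<C> X Y"
    and S: "S \<in> Obj \<A>" and f: "f \<in> Arr \<C> (on_ob J S) X"
  shows "Comp \<B> (on_ob H S) (on_ob L X) (on_ob L Y) (on_arr L X Y g) (lan_cocone \<A> \<C> \<B> J H L \<eta> X S f)
    = lan_cocone \<A> \<C> \<B> J H L \<eta> Y S (Comp \<C> (on_ob J S) X Y g f)"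
proof -
  interpret J: efunctor \<A> \<C> J using lan by (simp add: efunctor_def is_lan_def)
  interpret H: efunctor \<A> \<B> H using lan by (simp add: efunctor_def is_lan_def)
  interpret L: efunctor \<C> \<B> L using lan by (simp add: efunctor_def is_lan_def)
  have "\<eta> S \<in> Arr \<B> (on_ob H S) (on_ob L (on_ob J S))"
    using lan S by (simp add: is_lan_def is_enat_def)
  then show ?thesis
    using X g S f by (simp add: lan_cocone_def H.cod.assoc)
qed

text \<open>For fully faithful \<open>J\<close> the weight at \<open>J S\<close> is representable,
  so the colimit is \<open>H S\<close> itself and the unit is the comparison.\<close>

lemma lan_unit_iso:
  assumes lan: "is_lan \<A> \<C> \<B> J H L \<eta>"
    and ff: "\<And>S S'. \<lbrakk>S \<in> Obj \<A>; S' \<in> Obj \<A>\<rbrakk> \<Longrightarrow>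
      is_viso (Hom \<A> S' S) (Hom \<C> (on_ob J S') (on_ob J S)) (on_arr J S' S)"
    and S: "S \<in> Obj \<A>"
  shows "\<exists>\<zeta>\<in>Arr \<B> (on_ob L (on_ob J S)) (on_ob H S).
    Comp \<B> (on_ob H S) (on_ob L (on_ob J S)) (on_ob H S) \<zeta> (\<eta> S) = Id \<B> (on_ob H S) \<and>
    Comp \<B> (on_ob L (on_ob J S)) (on_ob H S) (on_ob L (on_ob J S)) (\<eta> S) \<zeta> = Id \<B> (on_ob L (on_ob J S))"
proof -
  have J: "is_efun \<A> \<C> J" and H: "is_efun \<A> \<B> H" using lan by (simp_all add: is_lan_def)
  interpret J: efunctor \<A> \<C> J using lan by (simp add: efunctor_def is_lan_def)
  interpret H: efunctor \<A> \<B> H using lan by (simp add: efunctor_def is_lan_def)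
  interpret L: efunctor \<C> \<B> L using lan by (simp add: efunctor_def is_lan_def)
  have [simp]: "\<eta> S \<in> Arr \<B> (on_ob H S) (on_ob L (on_ob J S))" if "S \<in> Obj \<A>" for S
    using lan that by (simp add: is_lan_def is_enat_def)
  have \<eta>_nat: "Comp \<B> (on_ob H S') (on_ob H S) (on_ob L (on_ob J S)) (\<eta> S) (on_arr H S' S u)
      = Comp \<B> (on_ob H S') (on_ob L (on_ob J S')) (on_ob L (on_ob J S))
          (on_arr L (on_ob J S') (on_ob J S) (on_arr J S' S u)) (\<eta> S')"
    if "S' \<in> Obj \<A>" "u \<in> Arr \<A> S' S" for S' u
    using lan that S by (simp add: is_lan_def is_enat_def)
  \<comment> \<open>Full faithfulness gives an inverse of \<open>J\<close> on each hom into
    \<open>S\<close>.\<close>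
  define j where "j S' = inv_into (Arr \<A> S' S) (on_arr J S' S)" for S'
  have bij: "bij_betw (on_arr J S' S) (Arr \<A> S' S) (Arr \<C> (on_ob J S') (on_ob J S))" if "S' \<in> Obj \<A>" for S'
    using ff[OF S that] by (simp add: is_viso_def)
  have j_in [simp]: "j S' f \<in> Arr \<A> S' S"
    and J_j [simp]: "on_arr J S' S (j S' f) = f"
    if "S' \<in> Obj \<A>" "f \<in> Arr \<C> (on_ob J S') (on_ob J S)" for S' f
    using bij[OF that(1)] that(2) unfolding j_def
    by (metis bij_betw_imp_surj_on inv_into_into, metis bij_betw_inv_into_right)
  have j_J: "j S' (on_arr J S' S u) = u" if "S' \<in> Obj \<A>" "u \<in> Arr \<A> S' S" for S' u
    using bij[OF that(1)] that(2) unfolding j_def by (rule bij_betw_inv_into_left)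
  have j_comp: "j S'' (Comp \<C> (on_ob J S'') (on_ob J S') (on_ob J S) f (on_arr J S'' S' u))
      = Comp \<A> S'' S' S (j S' f) u"
    if "S' \<in> Obj \<A>" "S'' \<in> Obj \<A>" "u \<in> Arr \<A> S'' S'" "f \<in> Arr \<C> (on_ob J S') (on_ob J S)" for S' S'' u f
  proof -
    have "Comp \<C> (on_ob J S'') (on_ob J S') (on_ob J S) f (on_arr J S'' S' u)
        = on_arr J S'' S (Comp \<A> S'' S' S (j S' f) u)"
      using that S by simp
    then show ?thesis using that S by (simp only: j_J J.dom.comp_in j_in)
  qed
  let ?JS = "on_ob J S" and ?HS = "on_ob H S" and ?LJS = "on_ob L (on_ob J S)"
  \<comment> \<open>Transported along \<open>j\<close>, the weight becomes the representable at
    \<open>S\<close>, and \<open>?\<alpha>\<close> is the cocone that Yoneda assigns to the identity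
    of \<open>H S\<close>. Its mediating arrow \<open>\<zeta>\<close> is the inverse sought.\<close>
  let ?\<alpha> = "\<lambda>S'\<in>Obj \<A>. \<lambda>f\<in>Arr \<C> (on_ob J S') ?JS. on_arr H S' S (j S' f)"
  let ?\<kappa> = "lan_cocone \<A> \<C> \<B> J H L \<eta> ?JS"
  have "is_cocone \<A> \<C> \<B> J H ?JS ?HS ?\<alpha>"
    unfolding is_cocone_def
  proof (intro conjI ballI)
    fix S' assume S': "S' \<in> Obj \<A>"
    have "vhom (Hom \<C> (on_ob J S') ?JS) f g
        \<le> vhom (Hom \<B> (on_ob H S') ?HS) (on_arr H S' S (j S' f)) (on_arr H S' S (j S' g))"
      if "f \<in> Arr \<C> (on_ob J S') ?JS" "g \<in> Arr \<C> (on_ob J S') ?JS" for f g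
    proof -
      \<comment> \<open>\<open>J\<close> preserves homs exactly, so the inequality for
        \<open>?\<alpha>\<close> reduces to the one for \<open>H\<close>.\<close>
      have "vhom (Hom \<C> (on_ob J S') ?JS) (on_arr J S' S (j S' f)) (on_arr J S' S (j S' g))
          = vhom (Hom \<A> S' S) (j S' f) (j S' g)"
        using ff[OF S S', unfolded is_viso_def, THEN conjunct2] j_in[OF S' that(1)] j_in[OF S' that(2)]
        by simp
      then show ?thesis
        using that S S' H.arr_mono[of S' S "j S' f" "j S' g"] by simp
    qed
    then show "is_vfun (Hom \<C> (on_ob J S') ?JS) (Hom \<B> (on_ob H S') ?HS) (?\<alpha> S')"
      using S S' by (simp add: is_vfun_def)
  qed (use S in \<open>simp_all add: j_comp\<close>)
  then obtain \<zeta> where \<zeta>: "\<zeta> \<in> Arr \<B> ?LJS ?HS" and \<zeta>\<kappa>: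
    "\<And>S' f. \<lbrakk>S' \<in> Obj \<A>; f \<in> Arr \<C> (on_ob J S') ?JS\<rbrakk> \<Longrightarrow>
      Comp \<B> (on_ob H S') ?LJS ?HS \<zeta> (?\<kappa> S' f) = ?\<alpha> S' f"
    using universal_coconeD(3)[OF universal_lan_cocone[OF lan J.ob_in[OF S]] H.ob_in[OF S]] by blast
  \<comment> \<open>The leg at the identity of \<open>J S\<close> is \<open>\<eta> S\<close>, and
    \<open>?\<alpha>\<close> takes the identity to an identity.\<close>
  have "j S (Id \<C> ?JS) = Id \<A> S"
    using j_J[OF S, of "Id \<A> S"] S by simp
  then have 1: "Comp \<B> ?HS ?LJS ?HS \<zeta> (\<eta> S) = Id \<B> ?HS"
    using \<zeta>\<kappa>[OF S, of "Id \<C> ?JS"] S by (simp add: lan_cocone_def)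
  \<comment> \<open>On the leg at \<open>f\<close> the composite is \<open>\<eta> S\<close> after
    \<open>H (j S' f)\<close>, which naturality of \<open>\<eta>\<close> turns back into the
    leg.\<close>
  have 2: "Comp \<B> ?LJS ?HS ?LJS (\<eta> S) \<zeta> = Id \<B> ?LJS"
  proof (rule universal_cocone_unique[OF J H universal_lan_cocone[OF lan]])
    fix S' f assume S': "S' \<in> Obj \<A>" and f: "f \<in> Arr \<C> (on_ob J S') ?JS"
    have \<kappa>: "?\<kappa> S' f \<in> Arr \<B> (on_ob H S') ?LJS"
      using S S' f by (simp add: lan_cocone_def)
    have "Comp \<B> (on_ob H S') ?LJS ?LJS (Comp \<B> ?LJS ?HS ?LJS (\<eta> S) \<zeta>) (?\<kappa> S' f)
        = Comp \<B> (on_ob H S') ?HS ?LJS (\<eta> S) (?\<alpha> S' f)"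
      using S S' \<zeta> \<kappa> f \<zeta>\<kappa>[OF S' f] by (simp add: H.cod.assoc)
    also have "\<dots> = ?\<kappa> S' f"
      using S S' f by (simp add: \<eta>_nat lan_cocone_def)
    finally show "Comp \<B> (on_ob H S') ?LJS ?LJS (Comp \<B> ?LJS ?HS ?LJS (\<eta> S) \<zeta>) (?\<kappa> S' f)
        = Comp \<B> (on_ob H S') ?LJS ?LJS (Id \<B> ?LJS) (?\<kappa> S' f)"
      using S S' \<kappa> by simp
  qed (use S \<zeta> in simp_all)
  show ?thesis using \<zeta> 1 2 by blast
qed

text \<open>Two colimits of the same weighted diagram are isomorphic, naturally so if their legs are
  natural. The functor \<open>K\<close> reindexes the weights, so that the comparison can be made
  over objects of \<open>\<E>\<close> only.\<close>

lemma universal_cocone_nat_iso: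
  assumes J: "is_efun \<A> \<C> J" and H: "is_efun \<A> \<B> H" and K: "is_efun \<E> \<C> K"
    and F: "is_efun \<E> \<B> F" and G: "is_efun \<E> \<B> G"
    and \<kappa>: "\<And>X. X \<in> Obj \<E> \<Longrightarrow> universal_cocone \<A> \<C> \<B> J H (on_ob K X) (on_ob F X) (\<kappa> X)"
    and \<theta>: "\<And>X. X \<in> Obj \<E> \<Longrightarrow> universal_cocone \<A> \<C> \<B> J H (on_ob K X) (on_ob G X) (\<theta> X)"
    and \<kappa>_nat: "\<And>X Y g S f. \<lbrakk>X \<in> Obj \<E>; Y \<in> Obj \<E>; g \<in> Arr \<E> X Y; S \<in> Obj \<A>; f \<in> Arr \<C> (on_ob J S) (on_ob K X)\<rbrakk>
      \<Longrightarrow> Comp \<B> (on_ob H S) (on_ob F X) (on_ob F Y) (on_arr F X Y g) (\<kappa> X S f)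
        = \<kappa> Y S (Comp \<C> (on_ob J S) (on_ob K X) (on_ob K Y) (on_arr K X Y g) f)"
    and \<theta>_nat: "\<And>X Y g S f. \<lbrakk>X \<in> Obj \<E>; Y \<in> Obj \<E>; g \<in> Arr \<E> X Y; S \<in> Obj \<A>; f \<in> Arr \<C> (on_ob J S) (on_ob K X)\<rbrakk>
      \<Longrightarrow> Comp \<B> (on_ob H S) (on_ob G X) (on_ob G Y) (on_arr G X Y g) (\<theta> X S f)
        = \<theta> Y S (Comp \<C> (on_ob J S) (on_ob K X) (on_ob K Y) (on_arr K X Y g) f)"
  obtains \<phi> \<psi> where "is_enat \<E> \<B> G F \<phi>"
    "\<And>X. X \<in> Obj \<E> \<Longrightarrow> \<psi> X \<in> Arr \<B> (on_ob F X) (on_ob G X)"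
    "\<And>X. X \<in> Obj \<E> \<Longrightarrow> Comp \<B> (on_ob G X) (on_ob F X) (on_ob G X) (\<psi> X) (\<phi> X) = Id \<B> (on_ob G X)"
    "\<And>X. X \<in> Obj \<E> \<Longrightarrow> Comp \<B> (on_ob F X) (on_ob G X) (on_ob F X) (\<phi> X) (\<psi> X) = Id \<B> (on_ob F X)"
proof -
  interpret J: efunctor \<A> \<C> J using J by (simp add: efunctor_def)
  interpret H: efunctor \<A> \<B> H using H by (simp add: efunctor_def)
  interpret K: efunctor \<E> \<C> K using K by (simp add: efunctor_def)
  interpret F: efunctor \<E> \<B> F using F by (simp add: efunctor_def)
  interpret G: efunctor \<E> \<B> G using G by (simp add: efunctor_def)
  have \<kappa>_in [simp]: "\<kappa> X S f \<in> Arr \<B> (on_ob H S) (on_ob F X)"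
    and \<theta>_in [simp]: "\<theta> X S f \<in> Arr \<B> (on_ob H S) (on_ob G X)"
    if "X \<in> Obj \<E>" "S \<in> Obj \<A>" "f \<in> Arr \<C> (on_ob J S) (on_ob K X)" for X S f
    using is_cocone_in[OF universal_coconeD(2)[OF \<kappa>]] is_cocone_in[OF universal_coconeD(2)[OF \<theta>]] that
    by blast+
  have "\<exists>\<phi>. \<forall>X\<in>Obj \<E>. \<phi> X \<in> Arr \<B> (on_ob G X) (on_ob F X) \<and>
      (\<forall>S\<in>Obj \<A>. \<forall>f\<in>Arr \<C> (on_ob J S) (on_ob K X).
        Comp \<B> (on_ob H S) (on_ob G X) (on_ob F X) (\<phi> X) (\<theta> X S f) = \<kappa> X S f)"
    using universal_coconeD(3)[OF \<theta>] universal_coconeD(1,2)[OF \<kappa>] by (intro bchoice) blast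
  then obtain \<phi> where \<phi> [simp]: "\<And>X. X \<in> Obj \<E> \<Longrightarrow> \<phi> X \<in> Arr \<B> (on_ob G X) (on_ob F X)"
    and \<phi>\<theta> [simp]: "\<And>X S f. \<lbrakk>X \<in> Obj \<E>; S \<in> Obj \<A>; f \<in> Arr \<C> (on_ob J S) (on_ob K X)\<rbrakk> \<Longrightarrow>
        Comp \<B> (on_ob H S) (on_ob G X) (on_ob F X) (\<phi> X) (\<theta> X S f) = \<kappa> X S f"
    by blast
  have "\<exists>\<psi>. \<forall>X\<in>Obj \<E>. \<psi> X \<in> Arr \<B> (on_ob F X) (on_ob G X) \<and>
      (\<forall>S\<in>Obj \<A>. \<forall>f\<in>Arr \<C> (on_ob J S) (on_ob K X).
        Comp \<B> (on_ob H S) (on_ob F X) (on_ob G X) (\<psi> X) (\<kappa> X S f) = \<theta> X S f)"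
    using universal_coconeD(3)[OF \<kappa>] universal_coconeD(1,2)[OF \<theta>] by (intro bchoice) blast
  then obtain \<psi> where \<psi> [simp]: "\<And>X. X \<in> Obj \<E> \<Longrightarrow> \<psi> X \<in> Arr \<B> (on_ob F X) (on_ob G X)"
    and \<psi>\<kappa> [simp]: "\<And>X S f. \<lbrakk>X \<in> Obj \<E>; S \<in> Obj \<A>; f \<in> Arr \<C> (on_ob J S) (on_ob K X)\<rbrakk> \<Longrightarrow>
        Comp \<B> (on_ob H S) (on_ob F X) (on_ob G X) (\<psi> X) (\<kappa> X S f) = \<theta> X S f"
    by blast
  show ?thesis
  proof
    show "is_enat \<E> \<B> G F \<phi>"
      unfolding is_enat_def
    proof (intro conjI ballI)
      fix X Y g assume X: "X \<in> Obj \<E>" "Y \<in> Obj \<E>" and g: "g \<in> Arr \<E> X Y"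
      \<comment> \<open>Composed with the leg of \<open>\<theta> X\<close> at \<open>f\<close>, both
        sides become the leg of \<open>\<kappa> Y\<close> at \<open>K g\<close> after
        \<open>f\<close>.\<close>
      show "Comp \<B> (on_ob G X) (on_ob G Y) (on_ob F Y) (\<phi> Y) (on_arr G X Y g)
          = Comp \<B> (on_ob G X) (on_ob F X) (on_ob F Y) (on_arr F X Y g) (\<phi> X)"
        by (rule universal_cocone_unique[where Z = "on_ob F Y", OF J H \<theta>[OF X(1)]])
          (use X g in \<open>simp_all add: H.cod.assoc \<kappa>_nat \<theta>_nat\<close>)
    qed simp
  next
    fix X assume X: "X \<in> Obj \<E>"
    then show "\<psi> X \<in> Arr \<B> (on_ob F X) (on_ob G X)" by simp
    show "Comp \<B> (on_ob G X) (on_ob F X) (on_ob G X) (\<psi> X) (\<phi> X) = Id \<B> (on_ob G X)"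
      by (rule universal_cocone_unique[where Z = "on_ob G X", OF J H \<theta>[OF X]]) (use X in \<open>simp_all add: H.cod.assoc\<close>)
    show "Comp \<B> (on_ob F X) (on_ob G X) (on_ob F X) (\<phi> X) (\<psi> X) = Id \<B> (on_ob F X)"
      by (rule universal_cocone_unique[where Z = "on_ob F X", OF J H \<kappa>[OF X]]) (use X in \<open>simp_all add: H.cod.assoc\<close>)
  qed
qed

section \<open>Change of base\<close>

lemma d_star_simps [simp]:
  "vob (d_star X) = vob X" "vhom (d_star X) x' x = (if vhom X x' x then 1 else bot)"
  by (simp_all add: d_star_def)

lemma c_star_simps [simp]:
  "vob (c_star X) = vob X" "vhom (c_star X) x' x \<longleftrightarrow> vhom X x' x \<noteq> bot"
  by (simp_all add: c_star_def)

lemma discrete_preord_simps [simp]: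
  "vob (discrete_preord A) = A" "vhom (discrete_preord A) x' x \<longleftrightarrow> x' \<in> A \<and> x' = x"
  by (simp_all add: discrete_preord_def)

lemma vfun_cat_simps [simp]:
  "f \<in> vob (vfun_cat X Y) \<longleftrightarrow> is_vfun X Y f"
  "vhom (vfun_cat X Y) f g = (if is_vfun X Y f \<and> is_vfun X Y g
     then INF x\<in>vob X. vhom Y (f x) (g x) else bot)"
  by (simp_all add: vfun_cat_def)

lemma SetE_simps [simp]:
  "Obj (SetE U) = U" "Hom (SetE U) A B = d_star (discrete_preord (A \<rightarrow>\<^sub>E B))"
  "Id (SetE U) A = (\<lambda>x\<in>A. x)" "Comp (SetE U) A B C g f = compose A g f"
  by (simp_all add: SetE_def)

lemma VCat_simps [simp]:
  "X \<in> Obj (VCat U) \<longleftrightarrow> is_vcat X \<and> vob X \<in> U" "Hom (VCat U) X Y = vfun_cat X Y"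
  "Id (VCat U) X = (\<lambda>x\<in>vob X. x)" "Comp (VCat U) X Y Z g f = compose (vob X) g f"
  by (simp_all add: VCat_def)

lemma change_base_simps [simp]:
  "Obj (change_base \<A>) = Obj \<A>" "Hom (change_base \<A>) A B = d_star (Hom \<A> A B)"
  "Id (change_base \<A>) = Id \<A>" "Comp (change_base \<A>) = Comp \<A>"
  by (simp_all add: change_base_def)

lemma PreordE_simps [simp]:
  "X \<in> Obj (PreordE U) \<longleftrightarrow> is_vcat X \<and> vob X \<in> U" "Hom (PreordE U) X Y = d_star (vfun_cat X Y)"
  "Id (PreordE U) X = (\<lambda>x\<in>vob X. x)" "Comp (PreordE U) X Y Z g f = compose (vob X) g f"
  by (simp_all add: PreordE_def)

lemma D_fun_simps [simp]: "on_ob D_fun A = discrete_preord A" "on_arr D_fun A B f = f"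
  by (simp_all add: D_fun_def)

lemma d_fun_simps [simp]: "on_ob d_fun X = d_star X" "on_arr d_fun X Y f = f"
  by (simp_all add: d_fun_def)

lemma c_fun_simps [simp]: "on_ob c_fun X = c_star X" "on_arr c_fun X Y f = f"
  by (simp_all add: c_fun_def)

lemma DV_fun_simps [simp]:
  "on_ob DV_fun A = d_star (discrete_preord A)" "on_arr DV_fun A B f = f"
  by (simp_all add: DV_fun_def)

lemma C_fun_simps [simp]:
  "on_ob C_fun X = component X ` vob X"
  "on_arr C_fun X Y f = (\<lambda>a\<in>component X ` vob X. component Y (f a))"
  by (simp_all add: C_fun_def)

text \<open>At base \<open>bool\<close> this identifies \<open>DV_fun\<close> with
  \<open>D_fun\<close>, so the unit of the Kan extension \<open>T2\<close> is a transformation from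
  \<open>D T\<close> to \<open>T2 D\<close>.\<close>

lemma d_star_bool [simp]: "d_star X = (X :: ('a, bool) vcat)"
  by (cases X) (simp add: d_star_def one_bool_def)

lemma is_vcatI:
  assumes "\<And>x. x \<in> vob X \<Longrightarrow> 1 \<le> vhom X x x"
    and "\<And>x x' x''. \<lbrakk>x \<in> vob X; x' \<in> vob X; x'' \<in> vob X\<rbrakk> \<Longrightarrow> vhom X x' x * vhom X x'' x' \<le> vhom X x'' x"
    and "\<And>x' x. vhom X x' x \<noteq> bot \<Longrightarrow> x' \<in> vob X \<and> x \<in> vob X"
  shows "is_vcat X"
  using assms unfolding is_vcat_def by blast

lemma is_vcat_refl: "is_vcat X \<Longrightarrow> x \<in> vob X \<Longrightarrow> 1 \<le> vhom X x x"
  by (simp add: is_vcat_def)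

lemma is_vcat_trans:
  "\<lbrakk>is_vcat X; x \<in> vob X; x' \<in> vob X; x'' \<in> vob X\<rbrakk> \<Longrightarrow> vhom X x' x * vhom X x'' x' \<le> vhom X x'' x"
  unfolding is_vcat_def by blast

lemma is_vcat_vobD: "is_vcat X \<Longrightarrow> vhom X x' x \<noteq> bot \<Longrightarrow> x' \<in> vob X \<and> x \<in> vob X"
  unfolding is_vcat_def by blast

lemma is_preord_vobD: "is_vcat X \<Longrightarrow> vhom X x' x \<Longrightarrow> x' \<in> vob X \<and> x \<in> vob X"
  using is_vcat_vobD[of X x' x] by simp

lemma is_vcat_d_star:
  assumes X: "is_vcat X"
  shows "is_vcat (d_star X :: ('a, 'v::comm_quantale) vcat)"
proof (rule is_vcatI)
  fix x x' x'' assume "x \<in> vob (d_star X :: ('a, 'v) vcat)" "x' \<in> vob (d_star X :: ('a, 'v) vcat)"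
    "x'' \<in> vob (d_star X :: ('a, 'v) vcat)"
  then show "vhom (d_star X) x' x * vhom (d_star X) x'' x' \<le> (vhom (d_star X) x'' x :: 'v)"
    using is_vcat_trans[OF X, of x x' x''] by (auto simp: times_bool_def)
qed (use is_vcat_refl[OF X] is_vcat_vobD[OF X] in \<open>auto simp: one_bool_def split: if_splits\<close>)

lemma is_vcat_discrete_preord: "is_vcat (discrete_preord A)"
  by (rule is_vcatI) (auto simp: one_bool_def times_bool_def)

text \<open>Arrows and composites stay the same; the inequality for composition survives since
  \<open>1 * 1 = 1\<close> and \<open>bot\<close> absorbs.\<close>

lemma is_ecat_change_base:
  assumes "is_ecat \<A>"
  shows "is_ecat (change_base \<A> :: ('o, 'm, 'v::comm_quantale) ecat)"
proof -
  interpret ecategory \<A> using assms by (simp add: ecategory_def)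
  show ?thesis
    unfolding is_ecat_def change_base_simps d_star_simps
  proof (intro conjI ballI)
    fix A B C g g' f f'
    assume "A \<in> Obj \<A>" "B \<in> Obj \<A>" "C \<in> Obj \<A>" "g \<in> Arr \<A> B C" "g' \<in> Arr \<A> B C"
      "f \<in> Arr \<A> A B" "f' \<in> Arr \<A> A B"
    from comp_mono[OF this]
    show "(if vhom (Hom \<A> B C) g g' then 1 else bot) * (if vhom (Hom \<A> A B) f f' then 1 else bot)
      \<le> (if vhom (Hom \<A> A C) (Comp \<A> A B C g f) (Comp \<A> A B C g' f') then 1 else (bot :: 'v))"
      by (auto simp: times_bool_def)
  qed (simp_all add: is_vcat_d_star hom_vcat assoc)
qed

lemma is_efun_change_base:
  assumes "is_efun \<A> \<B> F"
  shows "is_efun (change_base \<A> :: ('o, 'm, 'v::comm_quantale) ecat) (change_base \<B>) F"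
proof -
  interpret efunctor \<A> \<B> F using assms by (simp add: efunctor_def)
  show ?thesis
    unfolding is_efun_def change_base_simps d_star_simps
    using arr_mono by (auto simp: is_ecat_change_base dom.ecat cod.ecat)
qed

section \<open>Connected components\<close>

lemma connected_in_refl [simp]: "connected_in X x x"
  by (simp add: connected_in_def)

lemma connected_in_sym: "connected_in X x y \<Longrightarrow> connected_in X y x"
  unfolding connected_in_def by (rule sympD[OF symp_rtranclp]) (auto simp: symp_def)

lemma connected_in_trans: "connected_in X x y \<Longrightarrow> connected_in X y z \<Longrightarrow> connected_in X x z"
  unfolding connected_in_def by (rule rtranclp_trans)

lemma connected_in_vhom: "vhom X x y \<Longrightarrow> connected_in X x y"
  by (auto simp: connected_in_def)

lemma connected_in_component: "connected_in X x (component X x)"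
  unfolding component_def by (rule someI) (rule connected_in_refl)

text \<open>Connected elements have equal classes, so \<open>SOME\<close> is applied to equal
  predicates and picks the same representative.\<close>

lemma component_eq: "connected_in X x y \<Longrightarrow> component X x = component X y"
  unfolding component_def by (rule arg_cong[where f = Eps]) (blast intro: connected_in_sym connected_in_trans)

lemma component_component [simp]: "component X (component X x) = component X x"
  by (rule component_eq[symmetric]) (rule connected_in_component)

text \<open>A zigzag cannot leave \<open>vob X\<close>, because \<open>vhom\<close> is
  \<open>False\<close> outside it.\<close>

lemma connected_in_vob:
  assumes "is_vcat X" "x \<in> vob X" "connected_in X x y"
  shows "y \<in> vob X"
  using assms(3) unfolding connected_in_def
  by (induction rule: rtranclp_induct) (use assms is_preord_vobD[OF assms(1)] in auto)

lemma component_in_vob: "is_vcat X \<Longrightarrow> x \<in> vob X \<Longrightarrow> component X x \<in> vob X"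
  by (rule connected_in_vob[OF _ _ connected_in_component])

lemma connected_in_map:
  assumes X: "is_vcat X" and f: "is_vfun X Y f" and "connected_in X x y"
  shows "connected_in Y (f x) (f y)"
  using assms(3) unfolding connected_in_def[of X]
proof (induction rule: rtranclp_induct)
  case (step y z)
  have "vhom Y (f x') (f x)" if "vhom X x' x" for x' x
    using f that is_preord_vobD[OF X that] by (auto simp: is_vfun_def)
  then have "connected_in Y (f y) (f z)"
    using step.hyps by (metis connected_in_vhom connected_in_sym)
  then show ?case by (rule connected_in_trans[OF step.IH])
qed simp

text \<open>The value of \<open>C_fun\<close> on \<open>f\<close> does not depend on the
  representative chosen; preservation of composites and naturality of the unit rest on this.\<close>

lemma component_map_component:
  assumes "is_vcat X" "is_vfun X Y f"
  shows "component Y (f (component X x)) = component Y (f x)"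
  using component_eq[OF connected_in_map[OF assms connected_in_component[of X x]]] by simp

lemma component_discrete_preord [simp]: "component (discrete_preord A) a = a"
proof -
  have "connected_in (discrete_preord A) a y \<Longrightarrow> a = y" for y
    unfolding connected_in_def by (induction rule: rtranclp_induct) auto
  then show ?thesis using connected_in_component by metis
qed

section \<open>Preorders among \<open>\<V>\<close>-categories\<close>

text \<open>The right adjoint of \<open>d_star\<close>. The membership conditions keep the junk
  values \<open>False\<close> even when \<open>1 = bot\<close>.\<close>

definition underlying :: "('a, 'v::comm_quantale) vcat \<Rightarrow> ('a, bool) vcat" where
  "underlying Z = \<lparr>vob = vob Z, vhom = (\<lambda>x' x. x' \<in> vob Z \<and> x \<in> vob Z \<and> 1 \<le> vhom Z x' x)\<rparr>"

lemma underlying_simps [simp]: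
  "vob (underlying Z) = vob Z"
  "vhom (underlying Z) x' x \<longleftrightarrow> x' \<in> vob Z \<and> x \<in> vob Z \<and> 1 \<le> vhom Z x' x"
  by (simp_all add: underlying_def)

lemma is_vcat_underlying:
  fixes Z :: "('a, 'v::comm_quantale) vcat"
  assumes Z: "is_vcat Z"
  shows "is_vcat (underlying Z)"
proof (rule is_vcatI)
  fix x x' x''
  assume x: "x \<in> vob (underlying Z)" "x' \<in> vob (underlying Z)" "x'' \<in> vob (underlying Z)"
  have "1 \<le> vhom Z x'' x" if "1 \<le> vhom Z x' x" "1 \<le> vhom Z x'' x'"
  proof -
    have "1 \<le> vhom Z x' x * vhom Z x'' x'"
      using times_mono[OF that] by simp
    also have "\<dots> \<le> vhom Z x'' x" using is_vcat_trans[OF Z] x by simp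
    finally show ?thesis .
  qed
  then show "vhom (underlying Z) x' x * vhom (underlying Z) x'' x' \<le> vhom (underlying Z) x'' x"
    using x by (auto simp: times_bool_def)
qed (use is_vcat_refl[OF Z] in \<open>auto simp: one_bool_def\<close>)

text \<open>The adjunction on arrows: where \<open>x' \<le> x\<close> fails, the hom of
  \<open>d_star X\<close> is \<open>bot\<close> and imposes no condition.\<close>

lemma is_vfun_d_star: "is_vfun (d_star X) Z f \<longleftrightarrow> is_vfun X (underlying Z) f"
  by (auto simp: is_vfun_def PiE_iff)

text \<open>The adjunction on homs: \<open>1\<close> lies below an infimum exactly when it lies
  below every term.\<close>

lemma underlying_vfun_cat: "underlying (vfun_cat (d_star X) Z) = vfun_cat X (underlying Z)"
proof (intro vcat.equality ext)
  show "vob (underlying (vfun_cat (d_star X) Z)) = vob (vfun_cat X (underlying Z))"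
    by (simp add: set_eq_iff is_vfun_d_star)
next
  fix f g
  show "vhom (underlying (vfun_cat (d_star X) Z)) f g = vhom (vfun_cat X (underlying Z)) f g"
  proof (cases "is_vfun X (underlying Z) f \<and> is_vfun X (underlying Z) g")
    case True
    then have "\<forall>x\<in>vob X. f x \<in> vob Z \<and> g x \<in> vob Z" by (auto simp: is_vfun_def)
    then show ?thesis using True by (simp add: is_vfun_d_star le_INF_iff)
  qed (auto simp: is_vfun_d_star)
qed simp

text \<open>Non-triviality makes \<open>1 \<le> bot\<close> fail, so the order can be recovered from
  the homs.\<close>

lemma underlying_d_star:
  assumes "(1::'v::comm_quantale) \<noteq> bot" "is_vcat X"
  shows "underlying (d_star X :: ('a, 'v) vcat) = X"
  using assms is_preord_vobD[OF assms(2)] by (intro vcat.equality ext) (auto simp: bot_unique)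

text \<open>This is full faithfulness of \<open>d_star\<close> in the enriched sense, with equal hom
  objects.\<close>

lemma vfun_cat_d_star:
  assumes "(1::'v::comm_quantale) \<noteq> bot" "(1::'v) = top" "is_vcat Y"
  shows "vfun_cat (d_star X) (d_star Y) = (d_star (vfun_cat X Y) :: (_, 'v) vcat)"
proof -
  have *: "is_vfun (d_star X) (d_star Y :: (_, 'v) vcat) f \<longleftrightarrow> is_vfun X Y f" for f
    by (simp add: is_vfun_d_star underlying_d_star[OF assms(1,3)])
  \<comment> \<open>For empty \<open>vob X\<close> the infimum is \<open>top\<close>; integrality
    identifies it with \<open>1\<close>.\<close>
  have **: "(INF x\<in>vob X. if vhom Y (f x) (g x) then 1 else bot) = (if \<forall>x\<in>vob X. vhom Y (f x) (g x) then 1 else bot :: 'v)"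
    for f g
  proof (cases "\<forall>x\<in>vob X. vhom Y (f x) (g x)")
    case True
    then have "(INF x\<in>vob X. if vhom Y (f x) (g x) then 1 else bot) = (INF x\<in>vob X. top :: 'v)"
      by (intro INF_cong) (simp_all add: assms)
    then show ?thesis using True by (simp add: assms)
  next
    case False
    then obtain x where "x \<in> vob X" "\<not> vhom Y (f x) (g x)" by blast
    then have "(INF x\<in>vob X. if vhom Y (f x) (g x) then 1 else bot) \<le> (bot :: 'v)"
      by (intro INF_lower2[of x]) auto
    then show ?thesis using False by (auto simp: bot_unique)
  qed
  show ?thesis
  proof (intro vcat.equality ext)
    fix f g
    show "vhom (vfun_cat (d_star X) (d_star Y) :: (_, 'v) vcat) f g = vhom (d_star (vfun_cat X Y)) f g"
      using **[of f g] by (cases "is_vfun X Y f \<and> is_vfun X Y g") (simp_all only: vfun_cat_simps d_star_simps *, auto)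
  qed (simp_all add: * set_eq_iff)
qed

lemma vfun_cat_discrete_preord:
  "vfun_cat (discrete_preord A) (discrete_preord B) = discrete_preord (A \<rightarrow>\<^sub>E B)"
proof -
  have *: "is_vfun (discrete_preord A) (discrete_preord B) f \<longleftrightarrow> f \<in> A \<rightarrow>\<^sub>E B" for f
    by (auto simp: is_vfun_def)
  show ?thesis
    by (intro vcat.equality ext) (auto simp: * intro: PiE_ext)
qed

section \<open>The adjunctions\<close>

lemma is_efun_D_fun:
  assumes "is_ecat (SetE U :: (_, _, 'v::comm_quantale) ecat)"
    and "is_ecat (PreordE U :: (_, _, 'v) ecat)"
  shows "is_efun (SetE U :: (_, _, 'v) ecat) (PreordE U) D_fun"
  using assms by (simp add: is_efun_def vfun_cat_discrete_preord is_vcat_discrete_preord del: vfun_cat_simps)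

lemma is_efun_d_fun:
  assumes "(1::'v::comm_quantale) \<noteq> bot" "(1::'v) = top"
    and "is_ecat (PreordE U :: (_, _, 'v) ecat)" "is_ecat (VCat U :: (_, _, 'v) ecat)"
  shows "is_efun (PreordE U :: (_, _, 'v) ecat) (VCat U) d_fun"
  using assms(3,4)
  by (auto simp: is_efun_def vfun_cat_d_star[OF assms(1,2)] is_vcat_d_star simp del: vfun_cat_simps)

text \<open>Representatives lie in the preorder itself, so closure of \<open>U\<close> under subsets
  makes the set of components small.\<close>

lemma is_efun_C_fun:
  assumes cats: "is_ecat (PreordE U :: (_, _, 'v::comm_quantale) ecat)" "is_ecat (SetE U :: (_, _, 'v) ecat)"
    and small: "\<And>A B. A \<in> U \<Longrightarrow> B \<subseteq> A \<Longrightarrow> B \<in> U"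
  shows "is_efun (PreordE U :: (_, _, 'v) ecat) (SetE U) C_fun"
  unfolding is_efun_def
proof (intro conjI ballI cats)
  fix X :: "('a, bool) vcat" assume "X \<in> Obj (PreordE U :: (_, _, 'v) ecat)"
  then show "on_ob C_fun X \<in> Obj (SetE U :: (_, _, 'v) ecat)"
    using small[of "vob X" "component X ` vob X"] component_in_vob[of X] by (simp add: image_subset_iff)
next
  fix X Y :: "('a, bool) vcat" and f
  assume "X \<in> Obj (PreordE U :: (_, _, 'v) ecat)" "Y \<in> Obj (PreordE U :: (_, _, 'v) ecat)"
    "f \<in> Arr (PreordE U :: (_, _, 'v) ecat) X Y"
  then show "on_arr C_fun X Y f \<in> Arr (SetE U :: (_, _, 'v) ecat) (on_ob C_fun X) (on_ob C_fun Y)"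
    using component_in_vob[of X] by (auto simp: is_vfun_def)
next
  fix X Y :: "('a, bool) vcat" and f g
  assume X: "X \<in> Obj (PreordE U :: (_, _, 'v) ecat)" and Y: "Y \<in> Obj (PreordE U :: (_, _, 'v) ecat)"
    and f: "f \<in> Arr (PreordE U :: (_, _, 'v) ecat) X Y" and g: "g \<in> Arr (PreordE U :: (_, _, 'v) ecat) X Y"
  have arr: "on_arr C_fun X Y f \<in> component X ` vob X \<rightarrow>\<^sub>E component Y ` vob Y"
    using X f component_in_vob[of X] by (auto simp: is_vfun_def)
  \<comment> \<open>Comparable maps have connected values, hence the same image under
    \<open>C_fun\<close>; this is what discrete homs require.\<close>
  have "on_arr C_fun X Y f = on_arr C_fun X Y g" if "\<forall>x\<in>vob X. vhom Y (f x) (g x)"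
    using that X component_in_vob[of X]
    by (auto simp: fun_eq_iff restrict_def intro!: component_eq[OF connected_in_vhom])
  then show "vhom (Hom (PreordE U :: (_, _, 'v) ecat) X Y) f g
    \<le> vhom (Hom (SetE U) (on_ob C_fun X) (on_ob C_fun Y)) (on_arr C_fun X Y f) (on_arr C_fun X Y g)"
    using arr by (auto simp del: C_fun_simps(2))
next
  fix X :: "('a, bool) vcat" assume "X \<in> Obj (PreordE U :: (_, _, 'v) ecat)"
  then show "on_arr C_fun X X (Id (PreordE U :: (_, _, 'v) ecat) X)
      = Id (SetE U :: (_, _, 'v) ecat) (on_ob C_fun X)"
    using component_in_vob[of X] by (auto simp: fun_eq_iff restrict_def)
next
  fix X Y Z :: "('a, bool) vcat" and g f
  assume "X \<in> Obj (PreordE U :: (_, _, 'v) ecat)" "Y \<in> Obj (PreordE U :: (_, _, 'v) ecat)"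
    "Z \<in> Obj (PreordE U :: (_, _, 'v) ecat)"
    "g \<in> Arr (PreordE U :: (_, _, 'v) ecat) Y Z" "f \<in> Arr (PreordE U :: (_, _, 'v) ecat) X Y"
  then show "on_arr C_fun X Z (Comp (PreordE U :: (_, _, 'v) ecat) X Y Z g f)
    = Comp (SetE U :: (_, _, 'v) ecat) (on_ob C_fun X) (on_ob C_fun Y) (on_ob C_fun Z)
        (on_arr C_fun Y Z g) (on_arr C_fun X Y f)"
    using component_in_vob[of X] component_map_component[of Y Z g]
    by (auto simp: fun_eq_iff restrict_def compose_def is_vfun_def[of X])
qed

text \<open>The unit sends an element to the representative of its component. Each point of a
  discrete preorder represents itself, so the counit is an identity.\<close>

lemma is_eadj_C_D:
  assumes cats: "is_ecat (PreordE U :: (_, _, 'v::comm_quantale) ecat)" "is_ecat (SetE U :: (_, _, 'v) ecat)"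
    and small: "\<And>A B. A \<in> U \<Longrightarrow> B \<subseteq> A \<Longrightarrow> B \<in> U"
  shows "is_eadj (PreordE U :: (_, _, 'v) ecat) (SetE U) C_fun D_fun
    (\<lambda>X. \<lambda>x\<in>vob X. component X x) (\<lambda>A. \<lambda>x\<in>A. x)"
  unfolding is_eadj_def is_enat_def Let_def
proof (intro conjI ballI)
  show "is_efun (PreordE U :: (_, _, 'v) ecat) (SetE U) C_fun"
    by (rule is_efun_C_fun) (use assms in auto)
  show "is_efun (SetE U :: (_, _, 'v) ecat) (PreordE U) D_fun"
    by (rule is_efun_D_fun) (use assms in auto)
next
  fix X :: "('a, bool) vcat" assume X: "X \<in> Obj (PreordE U :: (_, _, 'v) ecat)"
  then show "(\<lambda>x\<in>vob X. component X x)
      \<in> Arr (PreordE U :: (_, _, 'v) ecat) (on_ob efun_id X) (on_ob (D_fun \<circ>\<^sub>F C_fun) X)"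
    by (auto simp: is_vfun_def dest: component_eq[OF connected_in_vhom])
next
  fix X Y :: "('a, bool) vcat" and f
  assume "X \<in> Obj (PreordE U :: (_, _, 'v) ecat)" "Y \<in> Obj (PreordE U :: (_, _, 'v) ecat)"
    "f \<in> Arr (PreordE U :: (_, _, 'v) ecat) X Y"
  then show "Comp (PreordE U :: (_, _, 'v) ecat) (on_ob efun_id X) (on_ob efun_id Y)
      (on_ob (D_fun \<circ>\<^sub>F C_fun) Y) (\<lambda>x\<in>vob Y. component Y x) (on_arr efun_id X Y f)
    = Comp (PreordE U :: (_, _, 'v) ecat) (on_ob efun_id X) (on_ob (D_fun \<circ>\<^sub>F C_fun) X)
      (on_ob (D_fun \<circ>\<^sub>F C_fun) Y) (on_arr (D_fun \<circ>\<^sub>F C_fun) X Y f) (\<lambda>x\<in>vob X. component X x)"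
    using component_map_component[of X Y f]
    by (auto simp: fun_eq_iff compose_def restrict_def is_vfun_def)
next
  fix X :: "('a, bool) vcat" assume "X \<in> Obj (PreordE U :: (_, _, 'v) ecat)"
  then show "Comp (SetE U :: (_, _, 'v) ecat) (on_ob C_fun X) (on_ob C_fun (on_ob D_fun (on_ob C_fun X)))
        (on_ob C_fun X) (\<lambda>x\<in>on_ob C_fun X. x)
        (on_arr C_fun X (on_ob D_fun (on_ob C_fun X)) (\<lambda>x\<in>vob X. component X x))
      = Id (SetE U :: (_, _, 'v) ecat) (on_ob C_fun X)"
    using component_in_vob[of X] by (auto simp: fun_eq_iff compose_def restrict_def)
next
  fix A B :: "'a set" and f
  assume "A \<in> Obj (SetE U :: (_, _, 'v) ecat)" "B \<in> Obj (SetE U :: (_, _, 'v) ecat)"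
    "f \<in> Arr (SetE U :: (_, _, 'v) ecat) A B"
  then show "Comp (SetE U :: (_, _, 'v) ecat) (on_ob (C_fun \<circ>\<^sub>F D_fun) A) (on_ob (C_fun \<circ>\<^sub>F D_fun) B)
      (on_ob efun_id B) (\<lambda>x\<in>B. x) (on_arr (C_fun \<circ>\<^sub>F D_fun) A B f)
    = Comp (SetE U :: (_, _, 'v) ecat) (on_ob (C_fun \<circ>\<^sub>F D_fun) A) (on_ob efun_id A)
      (on_ob efun_id B) (on_arr efun_id A B f) (\<lambda>x\<in>A. x)"
    by (auto simp: fun_eq_iff compose_def restrict_def)
qed (auto simp: fun_eq_iff compose_def restrict_def is_vcat_discrete_preord)

text \<open>Transitivity is the absence of zero divisors: a product of two non-bottom homs is
  non-bottom and lies below the third. Reflexivity is non-triviality.\<close>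

lemma is_vcat_c_star:
  fixes X :: "('a, 'v::comm_quantale) vcat"
  assumes nontrivial: "(1::'v) \<noteq> bot"
    and no_zero_divisors: "\<And>r s::'v. r * s = bot \<Longrightarrow> r = bot \<or> s = bot" and X: "is_vcat X"
  shows "is_vcat (c_star X)"
proof (rule is_vcatI)
  fix x x' x'' assume x: "x \<in> vob (c_star X)" "x' \<in> vob (c_star X)" "x'' \<in> vob (c_star X)"
  then have "vhom X x' x * vhom X x'' x' \<le> vhom X x'' x" using is_vcat_trans[OF X] by simp
  then show "vhom (c_star X) x' x * vhom (c_star X) x'' x' \<le> vhom (c_star X) x'' x"
    using no_zero_divisors[of "vhom X x' x" "vhom X x'' x'"] by (auto simp: times_bool_def bot_unique)
next
  fix x assume "x \<in> vob (c_star X)"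
  then show "1 \<le> vhom (c_star X) x x"
    using nontrivial is_vcat_refl[OF X, of x] by (auto simp: one_bool_def bot_unique)
qed (use is_vcat_vobD[OF X] in simp)

lemma c_star_d_star: "(1::'v::comm_quantale) \<noteq> bot \<Longrightarrow> c_star (d_star Y :: ('a, 'v) vcat) = Y"
  by (intro vcat.equality ext) auto

lemma is_efun_c_fun:
  assumes nontrivial: "(1::'v::comm_quantale) \<noteq> bot" and integral: "(1::'v) = top"
    and no_zero_divisors: "\<And>r s::'v. r * s = bot \<Longrightarrow> r = bot \<or> s = bot"
    and cats: "is_ecat (VCat U :: (_, _, 'v) ecat)" "is_ecat (PreordE U :: (_, _, 'v) ecat)"
  shows "is_efun (VCat U :: (_, _, 'v) ecat) (PreordE U) c_fun"
proof -
  have arr: "is_vfun (c_star X) (c_star Y) f" if "is_vfun X Y f" for X Y :: "('a, 'v) vcat" and f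
    using that by (auto simp: is_vfun_def) (metis bot_unique)
  \<comment> \<open>One bottom term makes the infimum \<open>bot\<close>; otherwise the bound is
    \<open>1 = top\<close>.\<close>
  have mono: "(INF x\<in>vob X. vhom Y (f x) (g x)) \<le> (if \<forall>x\<in>vob X. vhom Y (f x) (g x) \<noteq> bot then 1 else bot)"
    for X Y :: "('a, 'v) vcat" and f g
    by (auto simp: integral intro: INF_lower2)
  show ?thesis
    using cats is_vcat_c_star[OF nontrivial no_zero_divisors] mono
    by (auto simp: is_efun_def arr)
qed

text \<open>Unit and counit are identity maps. The unit is a \<open>\<V>\<close>-functor because a
  non-bottom hom lies below \<open>top = 1\<close>; the counit uses that \<open>c_star\<close> after
  \<open>d_star\<close> is the identity.\<close>

lemma is_eadj_c_d:
  assumes nontrivial: "(1::'v::comm_quantale) \<noteq> bot" and integral: "(1::'v) = top"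
    and no_zero_divisors: "\<And>r s::'v. r * s = bot \<Longrightarrow> r = bot \<or> s = bot"
    and cats: "is_ecat (VCat U :: (_, _, 'v) ecat)" "is_ecat (PreordE U :: (_, _, 'v) ecat)"
  shows "is_eadj (VCat U :: (_, _, 'v) ecat) (PreordE U) c_fun d_fun
    (\<lambda>X. \<lambda>x\<in>vob X. x) (\<lambda>Y. \<lambda>x\<in>vob Y. x)"
  unfolding is_eadj_def is_enat_def Let_def
proof (intro conjI ballI)
  show "is_efun (VCat U :: (_, _, 'v) ecat) (PreordE U) c_fun"
    by (rule is_efun_c_fun) (use assms in auto)
  show "is_efun (PreordE U :: (_, _, 'v) ecat) (VCat U) d_fun"
    by (rule is_efun_d_fun) (use assms in auto)
qed (auto simp: fun_eq_iff compose_def restrict_def is_vfun_def c_star_d_star nontrivial integral)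

section \<open>\<open>\<V>\<close>-cat-ifications\<close>

text \<open>Homs of \<open>SetE\<close> are discrete, so an ordinary functor is automatically
  enriched.\<close>

lemma is_efun_set_endofunctor:
  assumes "set_endofunctor U T" "is_ecat (SetE U :: (_, _, 'v::comm_quantale) ecat)"
  shows "is_efun (SetE U :: (_, _, 'v) ecat) (SetE U) T"
  using assms by (auto simp: is_efun_def set_endofunctor_def)

text \<open>Since \<open>d_star\<close> is left adjoint to \<open>underlying\<close> and fully faithful, both sides speak about the
  same families of functions.\<close>

lemma is_cocone_d_star:
  assumes "(1::'v::comm_quantale) \<noteq> bot" "(1::'v) = top" and X: "is_vcat X"
  shows "is_cocone (SetE U :: (_, _, 'v) ecat) (VCat U) (VCat U) DV_fun (DV_fun \<circ>\<^sub>F T) (d_star X) Z \<alpha>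
    \<longleftrightarrow> is_cocone (SetE U :: (_, _, bool) ecat) (VCat U) (VCat U) DV_fun (DV_fun \<circ>\<^sub>F T) X (underlying Z) \<alpha>"
  by (simp add: is_cocone_def is_vfun_d_star underlying_vfun_cat vfun_cat_d_star[OF assms]
      del: vfun_cat_simps)

text \<open>The left adjoint \<open>d_star\<close> preserves this colimit, and the legs are the same
  functions.\<close>

lemma universal_cocone_d_star:
  fixes K X :: "('u, bool) vcat"
  assumes V: "(1::'v::comm_quantale) \<noteq> bot" "(1::'v) = top" and X: "is_vcat X"
    and \<kappa>: "universal_cocone (SetE U :: (_, _, bool) ecat) (VCat U) (VCat U) DV_fun (DV_fun \<circ>\<^sub>F T) X K \<kappa>"
  shows "universal_cocone (SetE U :: (_, _, 'v) ecat) (VCat U) (VCat U) DV_fun (DV_fun \<circ>\<^sub>F T)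
    (d_star X) (d_star K) \<kappa>"
  unfolding universal_cocone_def
proof (intro conjI ballI allI impI)
  have K: "is_vcat K" "vob K \<in> U"
    using universal_coconeD(1)[OF \<kappa>] by simp_all
  then show "d_star K \<in> Obj (VCat U :: (_, _, 'v) ecat)"
    by (simp add: is_vcat_d_star)
  show "is_cocone (SetE U :: (_, _, 'v) ecat) (VCat U) (VCat U) DV_fun (DV_fun \<circ>\<^sub>F T) (d_star X) (d_star K) \<kappa>"
    unfolding is_cocone_d_star[OF V X] underlying_d_star[OF V(1) K(1)] by (rule universal_coconeD(2)[OF \<kappa>])
  fix Z :: "('u, 'v) vcat" and \<alpha>
  assume Z: "Z \<in> Obj (VCat U :: (_, _, 'v) ecat)"
    and \<alpha>: "is_cocone (SetE U :: (_, _, 'v) ecat) (VCat U) (VCat U) DV_fun (DV_fun \<circ>\<^sub>F T) (d_star X) Z \<alpha>"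
  \<comment> \<open>Mediating arrows from \<open>d_star K\<close> to \<open>Z\<close> are those from
    \<open>K\<close> to \<open>underlying Z\<close>.\<close>
  have "\<exists>!k. k \<in> Arr (VCat U) K (underlying Z) \<and>
    (\<forall>S\<in>Obj (SetE U :: (_, _, bool) ecat). \<forall>f\<in>Arr (VCat U) (on_ob DV_fun S) X.
      Comp (VCat U) (on_ob (DV_fun \<circ>\<^sub>F T) S) K (underlying Z) k (\<kappa> S f) = \<alpha> S f)"
    using \<kappa> Z \<alpha>[unfolded is_cocone_d_star[OF V X]]
    unfolding universal_cocone_def by (simp add: is_vcat_underlying del: vfun_cat_simps)
  then show "\<exists>!k. k \<in> Arr (VCat U :: (_, _, 'v) ecat) (d_star K) Z \<and>
    (\<forall>S\<in>Obj (SetE U :: (_, _, 'v) ecat). \<forall>f\<in>Arr (VCat U :: (_, _, 'v) ecat) (on_ob DV_fun S) (d_star X).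
      Comp (VCat U) (on_ob (DV_fun \<circ>\<^sub>F T) S) (d_star K) Z k (\<kappa> S f) = \<alpha> S f)"
    by (simp add: is_vfun_d_star vfun_cat_d_star[OF V X])
qed

theorem theorem4p15:
  fixes U :: "'u set set"
    and T :: "('u set, 'u \<Rightarrow> 'u, 'u set, 'u \<Rightarrow> 'u) efun"
    and T2 :: "(('u, bool) vcat, 'u \<Rightarrow> 'u, ('u, bool) vcat, 'u \<Rightarrow> 'u) efun"
    and TV :: "(('u, 'v::comm_quantale) vcat, 'u \<Rightarrow> 'u, ('u, 'v) vcat, 'u \<Rightarrow> 'u) efun"
  assumes nontrivial: "(1::'v) \<noteq> bot"
    and integral: "(1::'v) = top"
    and no_zero_divisors: "\<And>r s::'v. r * s = bot \<Longrightarrow> r = bot \<or> s = bot"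
    and small_subset: "\<And>A B. A \<in> U \<Longrightarrow> B \<subseteq> A \<Longrightarrow> B \<in> U"
    and T: "set_endofunctor U T"
    and TV: "is_vcatification U T TV"
    and T2: "is_vcatification U T T2"
  shows "adjunction_lifts (PreordE U :: (_, _, 'v) ecat) (SetE U) C_fun D_fun
           (Coalg (PreordE U) T2) (Coalg (SetE U) T) forget forget
       \<and> adjunction_lifts (VCat U :: (_, _, 'v) ecat) (PreordE U) c_fun d_fun
           (Coalg (VCat U) TV) (Coalg (PreordE U) T2) forget forget"
proof -
  let ?Set = "SetE U :: ('u set, 'u \<Rightarrow> 'u, 'v) ecat" and ?Set2 = "SetE U :: ('u set, 'u \<Rightarrow> 'u, bool) ecat"
    and ?Preord = "PreordE U :: (('u, bool) vcat, 'u \<Rightarrow> 'u, 'v) ecat"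
    and ?Preord2 = "VCat U :: (('u, bool) vcat, 'u \<Rightarrow> 'u, bool) ecat"
    and ?VCat = "VCat U :: (('u, 'v) vcat, 'u \<Rightarrow> 'u, 'v) ecat"
  obtain \<theta> where lanV: "is_lan ?Set ?VCat ?VCat DV_fun (DV_fun \<circ>\<^sub>F T) TV \<theta>"
    using TV by (auto simp: is_vcatification_def)
  obtain \<eta> where lan2: "is_lan ?Set2 ?Preord2 ?Preord2 DV_fun (DV_fun \<circ>\<^sub>F T) T2 \<eta>"
    using T2 by (auto simp: is_vcatification_def)
  have efuns: "is_efun ?Set ?VCat DV_fun" "is_efun ?Set ?VCat (DV_fun \<circ>\<^sub>F T)" "is_efun ?VCat ?VCat TV"
    "is_efun ?Preord2 ?Preord2 T2"
    using lanV lan2 by (simp_all add: is_lan_def)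
  \<comment> \<open>The category laws are contained in the functoriality conditions of the Kan
    extensions.\<close>
  have cats: "is_ecat ?Set" "is_ecat ?VCat" "is_ecat ?Preord2"
    using efuns by (simp_all add: is_efun_def)
  have cat: "is_ecat ?Preord"
    unfolding PreordE_def by (rule is_ecat_change_base) (rule cats)
  \<comment> \<open>\<open>T2\<close> is enriched over preorders; base change makes it a functor
    enriched over \<open>\<V>\<close>-categories.\<close>
  have T2_efun: "is_efun ?Preord ?Preord T2"
    unfolding PreordE_def by (rule is_efun_change_base) (rule efuns)
  have T_efun: "is_efun ?Set ?Set T"
    by (rule is_efun_set_endofunctor) (rule T cats)+
  have d_efun: "is_efun ?Preord ?VCat d_fun"
    by (rule is_efun_d_fun) (rule nontrivial integral cat cats)+

  \<comment> \<open>The isomorphism between \<open>D T\<close> and \<open>T2 D\<close>, and the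
    lifting of the components adjunction\<close>
  have ff: "is_viso (Hom ?Set2 S' S) (Hom ?Preord2 (on_ob DV_fun S') (on_ob DV_fun S)) (on_arr DV_fun S' S)"
    for S S'
    by (simp add: is_viso_def bij_betw_def inj_on_def image_def vfun_cat_discrete_preord del: vfun_cat_simps)
  have "\<exists>\<zeta>. \<forall>S\<in>U. \<zeta> S \<in> Arr ?Preord2 (on_ob T2 (on_ob DV_fun S)) (on_ob (DV_fun \<circ>\<^sub>F T) S) \<and>
    Comp ?Preord2 (on_ob (DV_fun \<circ>\<^sub>F T) S) (on_ob T2 (on_ob DV_fun S)) (on_ob (DV_fun \<circ>\<^sub>F T) S) (\<zeta> S) (\<eta> S)
      = Id ?Preord2 (on_ob (DV_fun \<circ>\<^sub>F T) S) \<and>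
    Comp ?Preord2 (on_ob T2 (on_ob DV_fun S)) (on_ob (DV_fun \<circ>\<^sub>F T) S) (on_ob T2 (on_ob DV_fun S)) (\<eta> S) (\<zeta> S)
      = Id ?Preord2 (on_ob T2 (on_ob DV_fun S))"
  proof (intro bchoice ballI)
    fix S assume "S \<in> U"
    then show "\<exists>\<zeta>. \<zeta> \<in> Arr ?Preord2 (on_ob T2 (on_ob DV_fun S)) (on_ob (DV_fun \<circ>\<^sub>F T) S) \<and>
    Comp ?Preord2 (on_ob (DV_fun \<circ>\<^sub>F T) S) (on_ob T2 (on_ob DV_fun S)) (on_ob (DV_fun \<circ>\<^sub>F T) S) \<zeta> (\<eta> S)
      = Id ?Preord2 (on_ob (DV_fun \<circ>\<^sub>F T) S) \<and>
    Comp ?Preord2 (on_ob T2 (on_ob DV_fun S)) (on_ob (DV_fun \<circ>\<^sub>F T) S) (on_ob T2 (on_ob DV_fun S)) (\<eta> S) \<zeta>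
      = Id ?Preord2 (on_ob T2 (on_ob DV_fun S))"
      using lan_unit_iso[OF lan2 ff, of S] by (simp add: Bex_def del: vfun_cat_simps)
  qed
  \<comment> \<open>From \<open>?Preord2\<close> to \<open>?Preord\<close> only the hom values
    change, not arrows or composites, so inverses remain inverses.\<close>
  then obtain \<zeta> where \<zeta>:
    "\<And>S. S \<in> U \<Longrightarrow> \<zeta> S \<in> Arr ?Preord (on_ob T2 (on_ob D_fun S)) (on_ob D_fun (on_ob T S))"
    "\<And>S. S \<in> U \<Longrightarrow> Comp ?Preord (on_ob D_fun (on_ob T S)) (on_ob T2 (on_ob D_fun S)) (on_ob D_fun (on_ob T S))
      (\<zeta> S) (\<eta> S) = Id ?Preord (on_ob D_fun (on_ob T S))"
    "\<And>S. S \<in> U \<Longrightarrow> Comp ?Preord (on_ob T2 (on_ob D_fun S)) (on_ob D_fun (on_ob T S)) (on_ob T2 (on_ob D_fun S))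
      (\<eta> S) (\<zeta> S) = Id ?Preord (on_ob T2 (on_ob D_fun S))"
    by auto
  have "is_enat ?Set2 ?Preord2 (DV_fun \<circ>\<^sub>F T) (T2 \<circ>\<^sub>F DV_fun) \<eta>"
    using lan2 by (simp add: is_lan_def)
  then have \<eta>: "is_enat ?Set ?Preord (D_fun \<circ>\<^sub>F T) (T2 \<circ>\<^sub>F D_fun) \<eta>"
    by (simp add: is_enat_def)
  have CD: "adjunction_lifts ?Preord ?Set C_fun D_fun (Coalg ?Preord T2) (Coalg ?Set T) forget forget"
    by (rule adjunction_lifts_Coalg[OF is_eadj_C_D T2_efun T_efun \<eta>, of \<zeta>])
      (use cat cats small_subset \<zeta> in simp_all)

  \<comment> \<open>The isomorphism between \<open>d_star T2\<close> and \<open>TV d_star\<close>,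
    and the lifting of the second adjunction\<close>
  have F: "is_efun ?Preord ?VCat (TV \<circ>\<^sub>F d_fun)" and G: "is_efun ?Preord ?VCat (d_fun \<circ>\<^sub>F T2)"
    by (rule is_efun_comp[OF d_efun efuns(3)], rule is_efun_comp[OF T2_efun d_efun])
  \<comment> \<open>Both families are universal for the weight at \<open>d_star X\<close>:
    \<open>?\<kappa>\<close> by evaluating the extension \<open>TV\<close> there,
    \<open>?\<mu>\<close> by carrying the colimit \<open>T2 X\<close> along
    \<open>d_star\<close>.\<close>
  let ?\<kappa> = "\<lambda>X. lan_cocone ?Set ?VCat ?VCat DV_fun (DV_fun \<circ>\<^sub>F T) TV \<theta> (d_star X)"
  let ?\<mu> = "lan_cocone ?Set2 ?Preord2 ?Preord2 DV_fun (DV_fun \<circ>\<^sub>F T) T2 \<eta>"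
  obtain \<phi> \<psi> where \<phi>: "is_enat ?Preord ?VCat (d_fun \<circ>\<^sub>F T2) (TV \<circ>\<^sub>F d_fun) \<phi>"
    and \<psi>: "\<And>X. X \<in> Obj ?Preord \<Longrightarrow> \<psi> X \<in> Arr ?VCat (on_ob (TV \<circ>\<^sub>F d_fun) X) (on_ob (d_fun \<circ>\<^sub>F T2) X)"
      "\<And>X. X \<in> Obj ?Preord \<Longrightarrow> Comp ?VCat (on_ob (d_fun \<circ>\<^sub>F T2) X) (on_ob (TV \<circ>\<^sub>F d_fun) X) (on_ob (d_fun \<circ>\<^sub>F T2) X)
        (\<psi> X) (\<phi> X) = Id ?VCat (on_ob (d_fun \<circ>\<^sub>F T2) X)"
      "\<And>X. X \<in> Obj ?Preord \<Longrightarrow> Comp ?VCat (on_ob (TV \<circ>\<^sub>F d_fun) X) (on_ob (d_fun \<circ>\<^sub>F T2) X) (on_ob (TV \<circ>\<^sub>F d_fun) X)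
        (\<phi> X) (\<psi> X) = Id ?VCat (on_ob (TV \<circ>\<^sub>F d_fun) X)"
  proof (rule universal_cocone_nat_iso[OF efuns(1,2) d_efun F G, of "?\<kappa>" "?\<mu>"])
    fix X assume X: "X \<in> Obj ?Preord"
    show "universal_cocone ?Set ?VCat ?VCat DV_fun (DV_fun \<circ>\<^sub>F T) (on_ob d_fun X) (on_ob (TV \<circ>\<^sub>F d_fun) X) (?\<kappa> X)"
      using universal_lan_cocone[OF lanV, of "d_star X"] X by (simp add: is_vcat_d_star)
    show "universal_cocone ?Set ?VCat ?VCat DV_fun (DV_fun \<circ>\<^sub>F T) (on_ob d_fun X) (on_ob (d_fun \<circ>\<^sub>F T2) X) (?\<mu> X)"
      using universal_cocone_d_star[OF nontrivial integral _ universal_lan_cocone[OF lan2, of X]] X by simp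
  next
    fix X Y g S f
    assume A: "X \<in> Obj ?Preord" "Y \<in> Obj ?Preord" "g \<in> Arr ?Preord X Y" "S \<in> Obj ?Set"
      "f \<in> Arr ?VCat (on_ob DV_fun S) (on_ob d_fun X)"
    \<comment> \<open>Arrows between images of \<open>d_star\<close> are monotone maps, so
      naturality of both cocones can be read off their own Kan extensions.\<close>
    have ff: "vfun_cat (d_star X) (d_star Y) = (d_star (vfun_cat X Y) :: (_, 'v) vcat)"
      "vfun_cat (d_star (discrete_preord S)) (d_star X) = (d_star (vfun_cat (discrete_preord S) X) :: (_, 'v) vcat)"
      using A by (simp_all add: vfun_cat_d_star[OF nontrivial integral])
    show "Comp ?VCat (on_ob (DV_fun \<circ>\<^sub>F T) S) (on_ob (TV \<circ>\<^sub>F d_fun) X) (on_ob (TV \<circ>\<^sub>F d_fun) Y)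
        (on_arr (TV \<circ>\<^sub>F d_fun) X Y g) (?\<kappa> X S f)
      = ?\<kappa> Y S (Comp ?VCat (on_ob DV_fun S) (on_ob d_fun X) (on_ob d_fun Y) (on_arr d_fun X Y g) f)"
      using lan_cocone_nat[OF lanV, of "d_star X" "d_star Y" g S f] A
      by (simp add: is_vcat_d_star ff del: vfun_cat_simps)
    show "Comp ?VCat (on_ob (DV_fun \<circ>\<^sub>F T) S) (on_ob (d_fun \<circ>\<^sub>F T2) X) (on_ob (d_fun \<circ>\<^sub>F T2) Y)
        (on_arr (d_fun \<circ>\<^sub>F T2) X Y g) (?\<mu> X S f)
      = ?\<mu> Y S (Comp ?VCat (on_ob DV_fun S) (on_ob d_fun X) (on_ob d_fun Y) (on_arr d_fun X Y g) f)"
      using lan_cocone_nat[OF lan2, of X Y g S f] A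
      by (simp add: ff del: vfun_cat_simps)
  qed (assumption | rule that)+
  have cd: "adjunction_lifts ?VCat ?Preord c_fun d_fun (Coalg ?VCat TV) (Coalg ?Preord T2) forget forget"
    by (rule adjunction_lifts_Coalg[OF is_eadj_c_d efuns(3) T2_efun \<phi>, of \<psi>])
      (use cat cats nontrivial integral no_zero_divisors \<psi> in \<open>simp_all del: VCat_simps PreordE_simps\<close>)
  show ?thesis using CD cd by blast
qed

end
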